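(* Let $n\ge 4$ and let $\Gamma$ be a type III quiver of mutation type $D_n$, with $\Gamma^{(1)}$ of mutation type $A_m$ and $\Gamma^{(2)}$ of mutation type $A_{n-m-2}$ ($1\le m\le n-3$), labelled by the type III labelling procedure. Let $\Phi$ be the root system of type $D_n$ with simple system $\Pi=\{\alpha_1,\ldots,\alpha_n\}$, and identify vertices with their labels. Then the set $\{\beta_i : i\in\Gamma_0\}\subseteq\Phi$ given by $$\beta_i=\begin{cases}\alpha_i+\ldots+\alpha_{i+a} & \text{if } i \text{ is a primary vertex and } i+a \text{ is the complementary vertex corresponding to } i,\\ \alpha_{m}+\ldots+\alpha_{n-2}+\alpha_{n-1} & \text{if } i=m,\\ \alpha_{m+1}+\ldots+\alpha_{n-2}+\alpha_{n-1} & \text{if } i=n-1,\\ \alpha_{m+1}+\ldots+\alpha_{n-2}+\alpha_{n} & \text{if } i=n,\\ \alpha_i & \text{otherwise}\end{cases}$$ is a companion basis for $\Gamma$.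
   Context: **Mutation type.** For a simply-laced Dynkin diagram $\Delta$, a quiver is of mutation type $\Delta$ if it is obtained by a finite sequence of (Fomin--Zelevinsky) quiver mutations from a quiver whose underlying graph is $\Delta$. $\Gamma_0$ denotes the vertex set of $\Gamma$. **Root system.** $\Phi$ is the root system of type $D_n$, with inner product $(\cdot,\cdot)$ normalized so that $(\alpha,\alpha)=2$ for all roots $\alpha$; the simple roots are numbered so that the Dynkin diagram is the chain $1 - 2 - \cdots - (n-2)$ with $n-2$ additionally joined to both $n-1$ and $n$. **Companion basis.** A companion basis for a quiver $\Gamma$ of mutation type $\Delta$ is a subset $\{\gamma_x : x\in\Gamma_0\}\subseteq\Phi$ (with $\Phi$ the root system of type $\Delta$) whose elements form a $\mathbb{Z}$-basis of the root lattice $\mathbb{Z}\Phi$ and such that for all distinct $x,y\in\Gamma_0$, $|(\gamma_x,\gamma_y)|$ equals the number of edges joining $x$ and $y$ in the underlying unoriented graph of $\Gamma$. **Structure of type $A$ quivers (known facts making the definitions below meaningful).** A quiver $Q$ of mutation type $A_k$ is connected; the only cycles in its underlying graph are 3-cycles, each of which is cyclically oriented in $Q$; every vertex has valency at most four and lies on at most two 3-cycles. An end vertex is a vertex that has valency zero, or valency one, or has valency two and belongs to a cyclically oriented 3-cycle; if $k\ge 2$ there are at least two end vertices. A string in $Q$ is a reduced walk in $Q$ that does not contain two consecutive arrows of any given 3-cycle; for any two vertices $i,j$ there is a unique string from $i$ to $j$ (trivial if $i=j$), and it visits no vertex twice. Let $p$ be a string from $i$ to $j$. For a 3-cycle with two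 vertices appearing in $p$, the first of these met when moving along $p$ from $i$ to $j$ is a primary vertex relative to $p$, the second is the secondary vertex corresponding to it relative to $p$, and the vertex of the 3-cycle not on $p$ is the complementary vertex corresponding to it relative to $p$. If $x,y,z$ are the vertices of a 3-cycle, the subquiver of $Q$ rooted at $x$ is the full subquiver on all vertices that can be reached on strings starting at $x$ which do not pass through $y$ or $z$; it is again a quiver of mutation type $A$, and $x$ is an end vertex of it. **Type $A$ labelling procedure.** The input is a quiver $Q$ of mutation type $A_k$ and an ordered pair of end vertices of $Q$, distinct if $k\ge 2$. If $k=1$, label the vertex $1$. If $k\ge 2$ with pair $(e,f)$, label $e$ by $1$ and let $p$ be the string from $e$ to $f$; move along $p$ from $e$ to $f$. If the current vertex has label $\ell$ and is not a primary vertex relative to $p$, label the next vertex of $p$ by $\ell+1$. If the current vertex has label $\ell$ and is a primary vertex relative to $p$ with corresponding complementary vertex $z$, let $Q'$ be the subquiver of $Q$ rooted at $z$ and let $a$ be its number of vertices; choose an end vertex $z'$ of $Q'$, distinct from $z$ if $a>1$; recursively label $Q'$ with $1,\ldots,a$ using the ordered pair $(z',z)$; add $\ell$ to each of these labels and assign the results to the corresponding vertices of $Q$; then label the next vertex on $p$ (the corresponding secondary vertex) by $\ell+a+1$. Continue until $f$ is labelled; it gets the label $k$. **Type III quivers.** Let $\Gamma^{(0)}$ be the oriented 4-cycle $c_1\to a\to c_2\to b\to c_1$ (so $c_1$ and $c_2$ are opposite vertices). $\Gamma$ is of type III if it is obtained from a disjoint union $\Gamma^{(0)}\sqcup\Gamma^{(1)}\sqcup\Gamma^{(2)}$,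 where $\Gamma^{(1)}$ and $\Gamma^{(2)}$ are quivers of mutation types $A_m$ and $A_{n-m-2}$ respectively for some $1\le m\le n-3$, by identifying some end vertices $v_1$ of $\Gamma^{(1)}$ and $v_2$ of $\Gamma^{(2)}$ with $c_1$ and $c_2$ respectively. **Labelling of a type III quiver.** Choose an ordered pair of end vertices (distinct if possible) of $\Gamma^{(1)}$ with $v_1$ the second vertex in the pair, apply the type $A$ labelling procedure to $\Gamma^{(1)}$ (so $v_1$ gets label $m$), and use these labels in $\Gamma$. Choose an ordered pair of end vertices (distinct if possible) of $\Gamma^{(2)}$ with $v_2$ the first vertex in the pair, apply the type $A$ labelling procedure to $\Gamma^{(2)}$, add $m$ to each label (giving labels $m+1,\ldots,n-2$, with $v_2$ labelled $m+1$), and use these labels in $\Gamma$. Label the remaining two vertices by $n-1$ and $n$, the vertex $b$ (which has an arrow to $c_1$) being labelled $n-1$ and the vertex $a$ being labelled $n$. **Vertex types in the labelled quiver.** If the vertices of a 3-cycle of $\Gamma^{(1)}$ or of $\Gamma^{(2)}$ have labels $i<j<k$, then $i$ is called a primary vertex, $j$ a complementary vertex (the complementary vertex corresponding to $i$), and $k$ a secondary vertex. A vertex of $\Gamma$ is primary (resp. complementary, secondary) if it is so in $\Gamma^{(1)}$ or $\Gamma^{(2)}$. *)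

theory Defs
  imports "HOL-Analysis.Analysis"
begin

section \<open>Quivers and mutation\<close>

text \<open>A quiver is given by its vertices and, for each ordered pair \<open>(x, y)\<close>, the number of
  arrows \<open>x \<rightarrow> y\<close>.  As usual in cluster theory, quivers are finite without loops and 2-cycles.\<close>

record 'v quiver =
  verts :: "'v set"
  arr :: "'v \<Rightarrow> 'v \<Rightarrow> nat"

definition wf_quiver :: "'v quiver \<Rightarrow> bool" where
  "wf_quiver Q \<longleftrightarrow> finite (verts Q) \<and>
     (\<forall>x y. arr Q x y > 0 \<longrightarrow> x \<in> verts Q \<and> y \<in> verts Q) \<and>
     (\<forall>x. arr Q x x = 0) \<and>
     (\<forall>x y. arr Q x y = 0 \<or> arr Q y x = 0)"

definition edges :: "'v quiver \<Rightarrow> 'v \<Rightarrow> 'v \<Rightarrow> nat" where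
  "edges Q x y = arr Q x y + arr Q y x"

definition valency :: "'v quiver \<Rightarrow> 'v \<Rightarrow> nat" where
  "valency Q x = (\<Sum>y\<in>verts Q. edges Q x y)"

definition full_subquiver :: "'v quiver \<Rightarrow> 'v set \<Rightarrow> 'v quiver" where
  "full_subquiver Q S =
     \<lparr> verts = verts Q \<inter> S, arr = (\<lambda>x y. if x \<in> S \<and> y \<in> S then arr Q x y else 0) \<rparr>"

text \<open>Mutation at \<open>k\<close>: add an arrow \<open>x \<rightarrow> y\<close> for every path \<open>x \<rightarrow> k \<rightarrow> y\<close>, reverse the arrows
  incident with \<open>k\<close>, and delete a maximal set of 2-cycles.  The last step is the truncated
  subtraction on the natural numbers.\<close>

definition mutate :: "'v \<Rightarrow> 'v quiver \<Rightarrow> 'v quiver" where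
  "mutate k Q =
     \<lparr> verts = verts Q,
       arr = (\<lambda>x y. if x = k \<or> y = k then arr Q y x
                    else (arr Q x y + arr Q x k * arr Q k y)
                       - (arr Q y x + arr Q y k * arr Q k x)) \<rparr>"

definition mutation_step :: "'v quiver \<Rightarrow> 'v quiver \<Rightarrow> bool" where
  "mutation_step Q Q' \<longleftrightarrow> (\<exists>k\<in>verts Q. Q' = mutate k Q)"

text \<open>A simply-laced diagram with \<open>n\<close> nodes is given by the relation, on \<open>{1..n}\<close>, of being joined
  by an edge.\<close>

definition A_joined :: "nat \<Rightarrow> nat \<Rightarrow> bool" where
  "A_joined i j \<longleftrightarrow> j = i + 1 \<or> i = j + 1"

definition D_joined :: "nat \<Rightarrow> nat \<Rightarrow> nat \<Rightarrow> bool" where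
  "D_joined n i j \<longleftrightarrow>
     (i \<le> n - 2 \<and> j \<le> n - 2 \<and> (j = i + 1 \<or> i = j + 1)) \<or>
     (i = n - 2 \<and> j \<in> {n - 1, n}) \<or> (j = n - 2 \<and> i \<in> {n - 1, n})"

definition has_underlying_graph :: "nat \<Rightarrow> (nat \<Rightarrow> nat \<Rightarrow> bool) \<Rightarrow> 'v quiver \<Rightarrow> bool" where
  "has_underlying_graph n J Q \<longleftrightarrow>
     (\<exists>f. bij_betw f {1..n} (verts Q) \<and>
          (\<forall>i\<in>{1..n}. \<forall>j\<in>{1..n}. edges Q (f i) (f j) = (if J i j then 1 else 0)))"

definition mutation_type :: "nat \<Rightarrow> (nat \<Rightarrow> nat \<Rightarrow> bool) \<Rightarrow> 'v quiver \<Rightarrow> bool" where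
  "mutation_type n J Q \<longleftrightarrow>
     (\<exists>Q0. wf_quiver Q0 \<and> has_underlying_graph n J Q0 \<and> mutation_step\<^sup>*\<^sup>* Q0 Q)"

abbreviation mutation_type_A :: "nat \<Rightarrow> 'v quiver \<Rightarrow> bool" where
  "mutation_type_A k \<equiv> mutation_type k A_joined"

abbreviation mutation_type_D :: "nat \<Rightarrow> 'v quiver \<Rightarrow> bool" where
  "mutation_type_D n \<equiv> mutation_type n (D_joined n)"


section \<open>Strings and the type A labelling procedure\<close>

text \<open>Quivers of mutation type A have no multiple arrows and all their 3-cycles are cyclically
  oriented.  So a 3-cycle is given by its vertex set and a walk by the list of its vertices.\<close>

definition three_cycles :: "'v quiver \<Rightarrow> 'v set set" where
  "three_cycles Q = {{x, y, z} | x y z. arr Q x y > 0 \<and> arr Q y z > 0 \<and> arr Q z x > 0}"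

definition end_vertex :: "'v quiver \<Rightarrow> 'v \<Rightarrow> bool" where
  "end_vertex Q x \<longleftrightarrow> x \<in> verts Q \<and>
     (valency Q x = 0 \<or> valency Q x = 1 \<or> (valency Q x = 2 \<and> (\<exists>T\<in>three_cycles Q. x \<in> T)))"

text \<open>In the last two conditions, \<open>p ! i \<noteq> p ! (i + 2)\<close> says that the walk is reduced; the other one
  excludes two consecutive arrows of a 3-cycle.\<close>

definition is_string :: "'v quiver \<Rightarrow> 'v list \<Rightarrow> bool" where
  "is_string Q p \<longleftrightarrow> p \<noteq> [] \<and> set p \<subseteq> verts Q \<and>
     (\<forall>i. i + 1 < length p \<longrightarrow> edges Q (p ! i) (p ! (i + 1)) > 0) \<and>
     (\<forall>i. i + 2 < length p \<longrightarrow> p ! i \<noteq> p ! (i + 2)) \<and>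
     (\<forall>i. i + 2 < length p \<longrightarrow> {p ! i, p ! (i + 1), p ! (i + 2)} \<notin> three_cycles Q)"

definition string_from_to :: "'v quiver \<Rightarrow> 'v \<Rightarrow> 'v \<Rightarrow> 'v list \<Rightarrow> bool" where
  "string_from_to Q x y p \<longleftrightarrow> is_string Q p \<and> hd p = x \<and> last p = y"

text \<open>The subquiver rooted at \<open>x\<close>, for a 3-cycle with vertices \<open>x\<close>, \<open>y\<close>, \<open>z\<close>.\<close>

definition rooted_subquiver :: "'v quiver \<Rightarrow> 'v \<Rightarrow> 'v \<Rightarrow> 'v \<Rightarrow> 'v quiver" where
  "rooted_subquiver Q x y z =
     full_subquiver Q {w. \<exists>p. string_from_to Q x w p \<and> y \<notin> set p \<and> z \<notin> set p}"

text \<open>Relative to \<open>p\<close>: \<open>x\<close> is a primary vertex, with corresponding complementary vertex \<open>z\<close> and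
  corresponding secondary vertex \<open>y\<close>.\<close>

definition primary_rel :: "'v quiver \<Rightarrow> 'v list \<Rightarrow> 'v \<Rightarrow> 'v \<Rightarrow> 'v \<Rightarrow> bool" where
  "primary_rel Q p x z y \<longleftrightarrow> {x, y, z} \<in> three_cycles Q \<and> z \<notin> set p \<and> x \<noteq> y \<and>
     (\<exists>i j. i < j \<and> j < length p \<and> p ! i = x \<and> p ! j = y)"

text \<open>\<open>A_labelling Q e f L\<close>: \<open>L\<close> restricted to the vertices of \<open>Q\<close> is a possible outcome of the
  labelling procedure for \<open>Q\<close> and the ordered pair \<open>(e, f)\<close>.  The procedure depends on choices of
  the end vertices \<open>z'\<close>, so this is a relation.  The values of \<open>L\<close> outside \<open>Q\<close> are irrelevant.\<close>

inductive A_labelling :: "'v quiver \<Rightarrow> 'v \<Rightarrow> 'v \<Rightarrow> ('v \<Rightarrow> nat) \<Rightarrow> bool" where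
  single: "verts Q = {e} \<Longrightarrow> L e = 1 \<Longrightarrow> A_labelling Q e e L"
| string: "card (verts Q) \<ge> 2 \<Longrightarrow> end_vertex Q e \<Longrightarrow> end_vertex Q f \<Longrightarrow> e \<noteq> f \<Longrightarrow>
    string_from_to Q e f p \<Longrightarrow> L e = 1 \<Longrightarrow>
    \<forall>i. i + 1 < length p \<longrightarrow>
      ((\<nexists>z y. primary_rel Q p (p ! i) z y) \<longrightarrow> L (p ! (i + 1)) = L (p ! i) + 1) \<and>
      (\<forall>z y Q' a. primary_rel Q p (p ! i) z y \<and>
          Q' = rooted_subquiver Q z (p ! i) y \<and> a = card (verts Q') \<longrightarrow>
          (\<exists>z' L'. end_vertex Q' z' \<and> (a > 1 \<longrightarrow> z' \<noteq> z) \<and> A_labelling Q' z' z L' \<and>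
            (\<forall>v\<in>verts Q'. L v = L (p ! i) + L' v)) \<and>
          L (p ! (i + 1)) = L (p ! i) + a + 1) \<Longrightarrow>
    A_labelling Q e f L"


section \<open>Type III quivers and their labelling\<close>

definition four_cycle :: "'v \<Rightarrow> 'v \<Rightarrow> 'v \<Rightarrow> 'v \<Rightarrow> 'v quiver" where
  "four_cycle c1 a c2 b =
     \<lparr> verts = {c1, a, c2, b},
       arr = (\<lambda>x y. if (x, y) \<in> {(c1, a), (a, c2), (c2, b), (b, c1)} then 1 else 0) \<rparr>"

definition quiver_union :: "'v quiver \<Rightarrow> 'v quiver \<Rightarrow> 'v quiver" where
  "quiver_union Q R =
     \<lparr> verts = verts Q \<union> verts R, arr = (\<lambda>x y. arr Q x y + arr R x y) \<rparr>"

text \<open>The three pieces are taken inside the glued quiver: identifying vertices of a disjoint union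
  amounts to a union in which the pieces meet in exactly the identified vertices.
  So \<open>c1\<close> is also the end vertex \<open>v\<^sub>1\<close> of \<open>G1\<close>, and \<open>c2\<close> the end vertex \<open>v\<^sub>2\<close> of \<open>G2\<close>.\<close>

definition type_III ::
  "nat \<Rightarrow> nat \<Rightarrow> 'v quiver \<Rightarrow> 'v quiver \<Rightarrow> 'v \<Rightarrow> 'v \<Rightarrow> 'v \<Rightarrow> 'v \<Rightarrow> 'v quiver \<Rightarrow> bool" where
  "type_III n m G1 G2 c1 a c2 b G \<longleftrightarrow>
     1 \<le> m \<and> m + 3 \<le> n \<and> distinct [c1, a, c2, b] \<and>
     mutation_type_A m G1 \<and> mutation_type_A (n - m - 2) G2 \<and>
     end_vertex G1 c1 \<and> end_vertex G2 c2 \<and>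
     verts (four_cycle c1 a c2 b) \<inter> verts G1 = {c1} \<and>
     verts (four_cycle c1 a c2 b) \<inter> verts G2 = {c2} \<and>
     verts G1 \<inter> verts G2 = {} \<and>
     G = quiver_union (four_cycle c1 a c2 b) (quiver_union G1 G2)"

definition type_III_labelling ::
  "nat \<Rightarrow> nat \<Rightarrow> 'v quiver \<Rightarrow> 'v quiver \<Rightarrow> 'v \<Rightarrow> 'v \<Rightarrow> 'v \<Rightarrow> 'v \<Rightarrow> ('v \<Rightarrow> nat) \<Rightarrow> bool" where
  "type_III_labelling n m G1 G2 c1 a c2 b L \<longleftrightarrow>
     (\<exists>u L1. A_labelling G1 u c1 L1 \<and> (\<forall>v\<in>verts G1. L v = L1 v)) \<and>
     (\<exists>u L2. A_labelling G2 c2 u L2 \<and> (\<forall>v\<in>verts G2. L v = L2 v + m)) \<and>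
     L b = n - 1 \<and> L a = n"

text \<open>\<open>i\<close> and \<open>j\<close> are labels: \<open>i\<close> is primary and \<open>j\<close> is the complementary vertex corresponding to it.\<close>

definition primary_complementary ::
  "'v quiver \<Rightarrow> 'v quiver \<Rightarrow> ('v \<Rightarrow> nat) \<Rightarrow> nat \<Rightarrow> nat \<Rightarrow> bool" where
  "primary_complementary G1 G2 L i j \<longleftrightarrow>
     (\<exists>x y z. {x, y, z} \<in> three_cycles G1 \<union> three_cycles G2 \<and>
              L x = i \<and> L y = j \<and> i < j \<and> j < L z)"

definition beta ::
  "nat \<Rightarrow> nat \<Rightarrow> 'v quiver \<Rightarrow> 'v quiver \<Rightarrow> ('v \<Rightarrow> nat) \<Rightarrow> (nat \<Rightarrow> 'a::real_vector) \<Rightarrow> nat \<Rightarrow> 'a" where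
  "beta n m G1 G2 L \<alpha> i =
     (if \<exists>j. primary_complementary G1 G2 L i j
        then \<Sum>k = i..(THE j. primary_complementary G1 G2 L i j). \<alpha> k
      else if i = m then (\<Sum>k = m..n - 2. \<alpha> k) + \<alpha> (n - 1)
      else if i = n - 1 then (\<Sum>k = m + 1..n - 2. \<alpha> k) + \<alpha> (n - 1)
      else if i = n then (\<Sum>k = m + 1..n - 2. \<alpha> k) + \<alpha> n
      else \<alpha> i)"


section \<open>Root systems\<close>

definition reflection :: "'a::euclidean_space \<Rightarrow> 'a \<Rightarrow> 'a" where
  "reflection r v = v - (2 * (v \<bullet> r) / (r \<bullet> r)) *\<^sub>R r"

definition cartan_number :: "'a::euclidean_space \<Rightarrow> 'a \<Rightarrow> real" where
  "cartan_number s r = 2 * (s \<bullet> r) / (r \<bullet> r)"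

definition root_system :: "'a::euclidean_space set \<Rightarrow> bool" where
  "root_system \<Phi> \<longleftrightarrow> finite \<Phi> \<and> 0 \<notin> \<Phi> \<and> span \<Phi> = UNIV \<and>
     (\<forall>r\<in>\<Phi>. \<forall>c. c *\<^sub>R r \<in> \<Phi> \<longleftrightarrow> c = 1 \<or> c = -1) \<and>
     (\<forall>r\<in>\<Phi>. reflection r ` \<Phi> = \<Phi>) \<and>
     (\<forall>r\<in>\<Phi>. \<forall>s\<in>\<Phi>. cartan_number s r \<in> \<int>)"

definition simple_system :: "'a::euclidean_space set \<Rightarrow> 'a set \<Rightarrow> bool" where
  "simple_system \<Phi> S \<longleftrightarrow> S \<subseteq> \<Phi> \<and> independent S \<and> span S = span \<Phi> \<and>
     (\<forall>r\<in>\<Phi>. \<exists>c :: 'a \<Rightarrow> int. r = (\<Sum>s\<in>S. of_int (c s) *\<^sub>R s) \<and>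
        ((\<forall>s\<in>S. c s \<ge> 0) \<or> (\<forall>s\<in>S. c s \<le> 0)))"

text \<open>\<open>\<Phi>\<close> is a root system of type \<open>D\<^sub>n\<close> with simple roots \<open>\<alpha> 1, \<dots>, \<alpha> n\<close>.  The number of edges
  joining two nodes of the Dynkin diagram is the product of the two Cartan integers.\<close>

definition root_system_D :: "nat \<Rightarrow> 'a::euclidean_space set \<Rightarrow> (nat \<Rightarrow> 'a) \<Rightarrow> bool" where
  "root_system_D n \<Phi> \<alpha> \<longleftrightarrow> root_system \<Phi> \<and> (\<forall>r\<in>\<Phi>. r \<bullet> r = 2) \<and>
     inj_on \<alpha> {1..n} \<and> simple_system \<Phi> (\<alpha> ` {1..n}) \<and>
     (\<forall>i\<in>{1..n}. \<forall>j\<in>{1..n}. i \<noteq> j \<longrightarrow>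
        cartan_number (\<alpha> i) (\<alpha> j) * cartan_number (\<alpha> j) (\<alpha> i) = (if D_joined n i j then 1 else 0))"


section \<open>Companion bases\<close>

text \<open>The real vector space as a \<open>\<int>\<close>-module; \<open>int_span \<Phi>\<close> is the root lattice.\<close>

global_interpretation int_mod: module "\<lambda>(k::int) (v::'a::real_vector). of_int k *\<^sub>R v"
  defines int_span = int_mod.span
    and int_dependent = int_mod.dependent
  by unfold_locales (simp_all add: scaleR_add_right scaleR_add_left)

text \<open>The basis is given as a family; the elements for distinct vertices are distinct.\<close>

definition companion_basis :: "'a::euclidean_space set \<Rightarrow> 'v quiver \<Rightarrow> ('v \<Rightarrow> 'a) \<Rightarrow> bool" where
  "companion_basis \<Phi> G \<gamma> \<longleftrightarrow>
     \<gamma> ` verts G \<subseteq> \<Phi> \<and>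
     inj_on \<gamma> (verts G) \<and> \<not> int_dependent (\<gamma> ` verts G) \<and>
     int_span (\<gamma> ` verts G) = int_span \<Phi> \<and>
     (\<forall>x\<in>verts G. \<forall>y\<in>verts G. x \<noteq> y \<longrightarrow> \<bar>\<gamma> x \<bullet> \<gamma> y\<bar> = real (edges G x y))"

end

theory Submission
  imports Defs "HOL-Library.Tree"
begin

text \<open>A quiver of mutation type \<open>A\<close> is the quiver of a triangulated polygon, and a triangulation seen
  from a diagonal is a pair of binary trees, one for each side: the node \<open>x\<close> with subtrees \<open>l\<close>, \<open>r\<close>
  stands for the arrows \<open>x \<rightarrow> root l \<rightarrow> root r \<rightarrow> x\<close>.  Such a description exists at one vertex if and only
  if it exists at every vertex, and mutation at \<open>k\<close> turns the subtrees \<open>(A, B), (C, D)\<close> around \<open>k\<close> into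
  \<open>(B, C), (D, A)\<close>, so the class is closed under mutation.  At an end vertex one side is empty, so the
  quiver is a single tree in which the strings from the root are the descending paths.

  With \<open>\<alpha>\<^sub>i = \<epsilon>\<^sub>i - \<epsilon>\<^bsub>i+1\<^esub>\<close>, the vectors attached to a type \<open>A\<close> piece are
  \<open>\<epsilon>\<^bsub>L x\<^esub> - \<epsilon>\<^bsub>s x\<^esub>\<close>, where \<open>s x\<close> is the label of the secondary vertex if \<open>x\<close> is primary and
  \<open>L x + 1\<close> otherwise.  The labelling is such that \<open>x\<close> and \<open>y\<close> are joined if and only if
  \<open>s x = L y\<close>, \<open>s y = L x\<close> or \<open>s x = s y\<close>, which is exactly the condition for the inner product to be
  \<open>\<plusminus>1\<close>.  The vectors of \<open>c1\<close>, \<open>b\<close>, \<open>a\<close> are \<open>\<epsilon>\<^sub>m - \<epsilon>\<^sub>n\<close>, \<open>\<epsilon>\<^bsub>m+1\<^esub> - \<epsilon>\<^sub>n\<close>, \<open>\<epsilon>\<^bsub>m+1\<^esub> + \<epsilon>\<^sub>n\<close>.\<close>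

section \<open>Type A quivers as binary trees\<close>

fun root_set :: "'v tree \<Rightarrow> 'v set" where
  "root_set Leaf = {}"
| "root_set (Node l x r) = {x}"

fun arrows :: "'v tree \<Rightarrow> ('v \<times> 'v) set" where
  "arrows Leaf = {}"
| "arrows (Node l x r) = arrows l \<union> arrows r \<union>
     {x} \<times> root_set l \<union> root_set l \<times> root_set r \<union> root_set r \<times> {x}"

fun uniq :: "'v tree \<Rightarrow> bool" where
  "uniq Leaf = True"
| "uniq (Node l x r) \<longleftrightarrow> uniq l \<and> uniq r \<and> x \<notin> set_tree l \<and> x \<notin> set_tree r \<and>
     set_tree l \<inter> set_tree r = {}"

text \<open>The vertex \<open>k\<close> is the diagonal from which the triangulation is seen. Each
  of the two trees describes one side of it, and they share only the root \<open>k\<close>.\<close>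

definition focus ::
  "'v quiver \<Rightarrow> 'v \<Rightarrow> 'v tree \<Rightarrow> 'v tree \<Rightarrow> 'v tree \<Rightarrow> 'v tree \<Rightarrow> bool" where
  "focus Q k A B C D \<longleftrightarrow> uniq (Node A k B) \<and> uniq (Node C k D) \<and>
     (set_tree A \<union> set_tree B) \<inter> (set_tree C \<union> set_tree D) = {} \<and>
     verts Q = set_tree (Node A k B) \<union> set_tree (Node C k D) \<and>
     arr Q = (\<lambda>x y. of_bool ((x, y) \<in> arrows (Node A k B) \<union> arrows (Node C k D)))"

definition tree_like :: "'v quiver \<Rightarrow> bool" where
  "tree_like Q \<longleftrightarrow> (\<exists>k A B C D. focus Q k A B C D)"

lemma root_set_subset: "root_set t \<subseteq> set_tree t"
  by (cases t) auto

lemma root_setD: "x \<in> root_set t \<Longrightarrow> y \<in> root_set t \<Longrightarrow> x = y"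
  by (cases t) auto

lemma arrows_subset: "arrows t \<subseteq> set_tree t \<times> set_tree t"
  by (induction t) (use root_set_subset in fastforce)+

lemma arrows_irrefl: "uniq t \<Longrightarrow> (x, x) \<notin> arrows t"
  by (induction t) (use root_set_subset in fastforce)+

lemma arrows_asym: "uniq t \<Longrightarrow> (x, y) \<in> arrows t \<Longrightarrow> (y, x) \<notin> arrows t"
proof (induction t arbitrary: x y)
  case (Node l z r)
  have *: "uniq l" "uniq r" "z \<notin> set_tree l" "z \<notin> set_tree r" "set_tree l \<inter> set_tree r = {}"
    using Node.prems by auto
  note sub = arrows_subset[of l] arrows_subset[of r] root_set_subset[of l] root_set_subset[of r]
  consider "x \<in> set_tree l" "y \<in> set_tree l" | "x \<in> set_tree r" "y \<in> set_tree r"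
    | "x = z" | "y = z" | "x \<in> set_tree l" "y \<in> set_tree r"
    | "y \<in> set_tree l" "x \<in> set_tree r"
    using Node.prems(2) sub by auto
  then show ?case
  proof cases
    case 1
    then have "(u, v) \<in> arrows (Node l z r) \<longleftrightarrow> (u, v) \<in> arrows l" if "{u, v} = {x, y}" for u v
      using that * sub by auto
    then show ?thesis using Node.IH(1)[OF *(1)] Node.prems(2) by (metis insert_commute)
  next
    case 2
    then have "(u, v) \<in> arrows (Node l z r) \<longleftrightarrow> (u, v) \<in> arrows r" if "{u, v} = {x, y}" for u v
      using that * sub by auto
    then show ?thesis using Node.IH(2)[OF *(2)] Node.prems(2) by (metis insert_commute)
  qed (use Node.prems(2) * sub in auto)
qed simp

section \<open>Unpacking and moving the focus\<close>

lemma focus_verts: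
  assumes "focus Q k A B C D"
  shows "verts Q = insert k (set_tree A \<union> set_tree B \<union> set_tree C \<union> set_tree D)"
proof -
  have "verts Q = set_tree (Node A k B) \<union> set_tree (Node C k D)"
    using assms unfolding focus_def by (elim conjE)
  then show ?thesis by auto
qed

lemma focus_disjoint:
  assumes "focus Q k A B C D"
  shows "uniq A" "uniq B" "uniq C" "uniq D"
    "set_tree A \<inter> set_tree B = {}" "set_tree A \<inter> set_tree C = {}" "set_tree A \<inter> set_tree D = {}"
    "set_tree B \<inter> set_tree C = {}" "set_tree B \<inter> set_tree D = {}" "set_tree C \<inter> set_tree D = {}"
    "k \<notin> set_tree A" "k \<notin> set_tree B" "k \<notin> set_tree C" "k \<notin> set_tree D"
proof -
  have "uniq (Node A k B)" "uniq (Node C k D)"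
    "(set_tree A \<union> set_tree B) \<inter> (set_tree C \<union> set_tree D) = {}"
    using assms unfolding focus_def by blast+
  then show "uniq A" "uniq B" "uniq C" "uniq D"
    "set_tree A \<inter> set_tree B = {}" "set_tree A \<inter> set_tree C = {}" "set_tree A \<inter> set_tree D = {}"
    "set_tree B \<inter> set_tree C = {}" "set_tree B \<inter> set_tree D = {}" "set_tree C \<inter> set_tree D = {}"
    "k \<notin> set_tree A" "k \<notin> set_tree B" "k \<notin> set_tree C" "k \<notin> set_tree D"
    by (simp_all, blast+)
qed

lemma focus_arr:
  assumes "focus Q k A B C D"
  shows "arr Q x y = of_bool ((x, y) \<in> arrows (Node A k B) \<union> arrows (Node C k D))"
proof -
  have "arr Q = (\<lambda>x y. of_bool ((x, y) \<in> arrows (Node A k B) \<union> arrows (Node C k D)))"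
    using assms unfolding focus_def by (elim conjE)
  then show ?thesis by (rule fun_cong[THEN fun_cong])
qed

lemma focusI:
  assumes "uniq (Node A k B)" "uniq (Node C k D)"
    and "(set_tree A \<union> set_tree B) \<inter> (set_tree C \<union> set_tree D) = {}"
    and "verts Q = set_tree (Node A k B) \<union> set_tree (Node C k D)"
    and "\<And>x y. arr Q x y = of_bool ((x, y) \<in> arrows (Node A k B) \<union> arrows (Node C k D))"
  shows "focus Q k A B C D"
  unfolding focus_def using assms(1-4) by (intro conjI ext assms(5))

lemma focus_swap:
  assumes "focus Q k A B C D"
  shows "focus Q k C D A B"
proof (rule focusI)
  show "arr Q x y = of_bool ((x, y) \<in> arrows (Node C k D) \<union> arrows (Node A k B))" for x y
    unfolding focus_arr[OF assms] by (simp only: Un_commute)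
qed (use focus_disjoint[OF assms] focus_verts[OF assms] in auto)

text \<open>The triangle \<open>k -> y -> root B -> k\<close> reads
  \<open>y -> root B -> k -> y\<close> when seen from \<open>y\<close>. So \<open>k\<close>,
  carrying its far side \<open>C\<close>, \<open>D\<close>, becomes the right child of
  \<open>y\<close>, next to \<open>B\<close>, while \<open>A1\<close>, \<open>A2\<close> form the
  other side of \<open>y\<close>.\<close>

lemma focus_left:
  assumes "focus Q k (Node A1 y A2) B C D"
  shows "focus Q y A1 A2 B (Node C k D)"
proof (rule focusI)
  show "arr Q u v = of_bool ((u, v) \<in> arrows (Node A1 y A2) \<union> arrows (Node B y (Node C k D)))" for u v
    unfolding focus_arr[OF assms] by (rule arg_cong[of _ _ of_bool]) auto
qed (use focus_disjoint[OF assms] focus_verts[OF assms] in auto)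

text \<open>Here the triangle is \<open>k -> root A -> y -> k\<close>, so \<open>k\<close> becomes
  the left child of \<open>y\<close>.\<close>

lemma focus_right:
  assumes "focus Q k A (Node B1 y B2) C D"
  shows "focus Q y B1 B2 (Node C k D) A"
proof (rule focusI)
  show "arr Q u v = of_bool ((u, v) \<in> arrows (Node B1 y B2) \<union> arrows (Node (Node C k D) y A))" for u v
    unfolding focus_arr[OF assms] by (rule arg_cong[of _ _ of_bool]) auto
qed (use focus_disjoint[OF assms] focus_verts[OF assms] in auto)

text \<open>The disjunction covers both positions of the tree to descend into: after one move its
  two subtrees are the left and the right child of the new focus, and the induction hypothesis
  applies to either.\<close>

lemma refocus_subtree:
  assumes "y \<in> set_tree A" "focus Q k A B C D \<or> focus Q k B A C D"
  shows "\<exists>A B C D. focus Q y A B C D"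
  using assms
proof (induction A arbitrary: k B C D)
  case (Node A1 z A2)
  obtain C' D' where f: "focus Q z A1 A2 C' D'"
    using Node.prems(2) focus_left focus_right by metis
  consider "y = z" | "y \<in> set_tree A1" | "y \<in> set_tree A2" using Node.prems(1) by auto
  then show ?case
  proof cases
    case 1 then show ?thesis using f by blast
  next
    case 2 then show ?thesis using Node.IH(1) f by blast
  next
    case 3 then show ?thesis using Node.IH(2) f by blast
  qed
qed simp

lemma tree_like_focus:
  assumes "tree_like Q" "y \<in> verts Q"
  obtains A B C D where "focus Q y A B C D"
proof -
  obtain k A B C D where f: "focus Q k A B C D" using assms(1) unfolding tree_like_def by blast
  have "y = k \<or> y \<in> set_tree A \<or> y \<in> set_tree B \<or> y \<in> set_tree C \<or> y \<in> set_tree D"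
    using assms(2) unfolding focus_verts[OF f] by blast
  then show thesis
    using that f refocus_subtree[of y] focus_swap[OF f] by metis
qed

section \<open>Mutation at the focus\<close>

lemma of_bool_add_diff:
  assumes "\<not> (p \<and> q)" "\<not> (p' \<and> q')"
  shows "(of_bool p + of_bool q) - (of_bool p' + of_bool q') = (of_bool ((p \<or> q) \<and> \<not> (p' \<or> q')) :: nat)"
  using assms by (cases p; cases q; cases p'; cases q') simp_all

text \<open>This counts the arrows from \<open>x\<close> to \<open>y\<close> after mutation, for
  \<open>x\<close> and \<open>y\<close> different from the mutated vertex. \<open>e\<close> and
  \<open>e'\<close> stand for an arrow \<open>x -> y\<close> or \<open>y -> x\<close> inside a
  subtree, \<open>a1\<close>, ..., \<open>d1\<close> for \<open>x\<close> being the root of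
  \<open>A\<close>, ..., \<open>D\<close>, and \<open>a2\<close>, ..., \<open>d2\<close> for the
  same about \<open>y\<close>. The composite arrows from \<open>B\<close> to \<open>A\<close> and
  from \<open>D\<close> to \<open>C\<close> cancel the old arrows from \<open>A\<close> to
  \<open>B\<close> and from \<open>C\<close> to \<open>D\<close>; the composites from
  \<open>B\<close> to \<open>C\<close> and from \<open>D\<close> to \<open>A\<close>
  survive.\<close>

lemma mutation_count:
  fixes e e' a1 b1 c1 d1 a2 b2 c2 d2 :: bool
  assumes "\<not> (e \<and> e')"
    and "\<not> (a1 \<and> b1)" "\<not> (a1 \<and> c1)" "\<not> (a1 \<and> d1)" "\<not> (b1 \<and> c1)"
      "\<not> (b1 \<and> d1)" "\<not> (c1 \<and> d1)" "\<not> (a2 \<and> b2)" "\<not> (a2 \<and> c2)"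
      "\<not> (a2 \<and> d2)" "\<not> (b2 \<and> c2)" "\<not> (b2 \<and> d2)" "\<not> (c2 \<and> d2)"
    and "a1 \<and> b2 \<longrightarrow> \<not> e \<and> \<not> e'" "a1 \<and> c2 \<longrightarrow> \<not> e \<and> \<not> e'" "a1 \<and> d2 \<longrightarrow> \<not> e \<and> \<not> e'"
      "b1 \<and> c2 \<longrightarrow> \<not> e \<and> \<not> e'" "b1 \<and> d2 \<longrightarrow> \<not> e \<and> \<not> e'" "c1 \<and> d2 \<longrightarrow> \<not> e \<and> \<not> e'"
      "a2 \<and> b1 \<longrightarrow> \<not> e \<and> \<not> e'" "a2 \<and> c1 \<longrightarrow> \<not> e \<and> \<not> e'" "a2 \<and> d1 \<longrightarrow> \<not> e \<and> \<not> e'"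
      "b2 \<and> c1 \<longrightarrow> \<not> e \<and> \<not> e'" "b2 \<and> d1 \<longrightarrow> \<not> e \<and> \<not> e'" "c2 \<and> d1 \<longrightarrow> \<not> e \<and> \<not> e'"
  shows "(of_bool (e \<or> a1 \<and> b2 \<or> c1 \<and> d2) + of_bool (b1 \<or> d1) * of_bool (a2 \<or> c2))
      - (of_bool (e' \<or> a2 \<and> b1 \<or> c2 \<and> d1) + of_bool (b2 \<or> d2) * of_bool (a1 \<or> c1))
    = (of_bool (e \<or> b1 \<and> c2 \<or> d1 \<and> a2) :: nat)"
proof -
  \<comment> \<open>Each of the two sums is at most 1, so the truncated subtraction reduces to a
    statement about truth values.\<close>
  have 1: "\<not> ((e \<or> a1 \<and> b2 \<or> c1 \<and> d2) \<and> ((b1 \<or> d1) \<and> (a2 \<or> c2)))"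
    using assms by argo
  have 2: "\<not> ((e' \<or> a2 \<and> b1 \<or> c2 \<and> d1) \<and> ((b2 \<or> d2) \<and> (a1 \<or> c1)))"
    using assms by argo
  have 3: "((e \<or> a1 \<and> b2 \<or> c1 \<and> d2) \<or> (b1 \<or> d1) \<and> (a2 \<or> c2)) \<and>
      \<not> ((e' \<or> a2 \<and> b1 \<or> c2 \<and> d1) \<or> (b2 \<or> d2) \<and> (a1 \<or> c1))
    \<longleftrightarrow> e \<or> b1 \<and> c2 \<or> d1 \<and> a2"
    using assms by argo
  show ?thesis unfolding of_bool_conj[symmetric] of_bool_add_diff[OF 1 2] 3 ..
qed

lemma focus_mutate:
  assumes "focus Q k A B C D"
  shows "focus (mutate k Q) k B C D A"
proof -
  \<comment> \<open>The arrows inside the four subtrees. Mutation at \<open>k\<close> leaves them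
    alone and only affects arrows among \<open>k\<close> and the four roots.\<close>
  define E where "E = arrows A \<union> arrows B \<union> arrows C \<union> arrows D"
  note d = focus_disjoint[OF assms]
  have mem: "x \<in> set_tree t \<and> y \<in> set_tree t" if "(x, y) \<in> arrows t" for t :: "'v tree" and x y
    using that arrows_subset by blast
  have dj: "S = T \<or> set_tree S \<inter> set_tree T = {}"
    if "S \<in> {A, B, C, D}" "T \<in> {A, B, C, D}" for S T
    using that by (elim insertE emptyE) (simp_all add: d(5-10) d(5-10)[THEN trans[OF Int_commute]])
  \<comment> \<open>The subtrees are pairwise disjoint, so an arrow of \<open>E\<close> that touches
    one of them lies in it.\<close>
  have loc: "(u, v) \<in> arrows S"
    if "(u, v) \<in> E" "u \<in> set_tree S \<or> v \<in> set_tree S" "S \<in> {A, B, C, D}" for u v S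
  proof -
    have "\<exists>T\<in>{A, B, C, D}. (u, v) \<in> arrows T"
      using that(1) unfolding E_def by simp
    then obtain T where T: "T \<in> {A, B, C, D}" "(u, v) \<in> arrows T" by blast
    have "S = T" using dj[OF that(3) T(1)] mem[OF T(2)] that(2) by blast
    then show ?thesis using T by simp
  qed
  have asym: "(y, x) \<notin> E" if xy: "(x, y) \<in> E" for x y
  proof
    assume yx: "(y, x) \<in> E"
    have "\<exists>T\<in>{A, B, C, D}. (x, y) \<in> arrows T"
      using xy unfolding E_def by simp
    then obtain T where T: "T \<in> {A, B, C, D}" "(x, y) \<in> arrows T" by blast
    have "(y, x) \<in> arrows T" using loc[OF yx _ T(1)] mem[OF T(2)] by blast
    moreover have "uniq T" using T(1) d(1-4) by auto
    ultimately show False using arrows_asym T(2) by metis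
  qed
  have kE: "(k, x) \<notin> E" "(x, k) \<notin> E" for x
    using d(11-14) by (auto simp: E_def dest: mem)
  have rd: "root_set A \<inter> root_set B = {}" "root_set A \<inter> root_set C = {}" "root_set A \<inter> root_set D = {}"
    "root_set B \<inter> root_set C = {}" "root_set B \<inter> root_set D = {}" "root_set C \<inter> root_set D = {}"
    "k \<notin> root_set A" "k \<notin> root_set B" "k \<notin> root_set C" "k \<notin> root_set D"
    using d(5-) root_set_subset[of A] root_set_subset[of B] root_set_subset[of C]
      root_set_subset[of D] by fast+
  have cr: "(x, y) \<notin> E" if "x \<in> root_set S" "y \<in> root_set T"
      "S \<in> {A, B, C, D}" "T \<in> {A, B, C, D}" "set_tree S \<inter> set_tree T = {}" for x y S T
  proof
    assume "(x, y) \<in> E"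
    moreover have "x \<in> set_tree S" using that(1) root_set_subset by (rule set_rev_mp)
    ultimately have "(x, y) \<in> arrows S" using that(3) by (intro loc disjI1)
    then have "y \<in> set_tree S" by (rule mem[THEN conjunct2])
    moreover have "y \<in> set_tree T" using that(2) root_set_subset by (rule set_rev_mp)
    ultimately show False using that(5) by auto
  qed
  have cr2: "(x, y) \<notin> E \<and> (y, x) \<notin> E" if "x \<in> root_set S" "y \<in> root_set T"
      "S \<in> {A, B, C, D}" "T \<in> {A, B, C, D}" "set_tree S \<inter> set_tree T = {}" for x y S T
    using cr[OF that] cr[OF that(2,1,4,3)] that(5) by (simp add: Int_commute)
  note cross' = cr2[of _ A _ B, OF _ _ _ _ d(5), simplified] cr2[of _ A _ C, OF _ _ _ _ d(6), simplified]
    cr2[of _ A _ D, OF _ _ _ _ d(7), simplified] cr2[of _ B _ C, OF _ _ _ _ d(8), simplified]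
    cr2[of _ B _ D, OF _ _ _ _ d(9), simplified] cr2[of _ C _ D, OF _ _ _ _ d(10), simplified]
  have cross_swap: "(y, x) \<notin> E \<and> (x, y) \<notin> E"
    if "(x, y) \<notin> E \<and> (y, x) \<notin> E" for x y using that by blast
  have asym': "\<not> ((x, y) \<in> E \<and> (y, x) \<in> E)" for x y using asym by blast
  have rdx: "\<not> (x \<in> root_set A \<and> x \<in> root_set B)" "\<not> (x \<in> root_set A \<and> x \<in> root_set C)"
    "\<not> (x \<in> root_set A \<and> x \<in> root_set D)" "\<not> (x \<in> root_set B \<and> x \<in> root_set C)"
    "\<not> (x \<in> root_set B \<and> x \<in> root_set D)" "\<not> (x \<in> root_set C \<and> x \<in> root_set D)" for x
    using rd(1-6) by (simp_all add: disjoint_iff)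
  have arrQ: "arr Q x y = of_bool ((x, y) \<in> E \<or> x = k \<and> y \<in> root_set A \<or> x = k \<and> y \<in> root_set C
      \<or> x \<in> root_set B \<and> y = k \<or> x \<in> root_set D \<and> y = k
      \<or> x \<in> root_set A \<and> y \<in> root_set B \<or> x \<in> root_set C \<and> y \<in> root_set D)" for x y
    unfolding focus_arr[OF assms] E_def by (rule arg_cong[of _ _ of_bool]) auto
  have "arr (mutate k Q) x y
      = of_bool ((x, y) \<in> arrows (Node B k C) \<union> arrows (Node D k A))" for x y
  proof -
    have new: "(x, y) \<in> arrows (Node B k C) \<union> arrows (Node D k A) \<longleftrightarrow>
      ((x, y) \<in> E \<or> x = k \<and> y \<in> root_set B \<or> x = k \<and> y \<in> root_set D
      \<or> x \<in> root_set C \<and> y = k \<or> x \<in> root_set A \<and> y = k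
      \<or> x \<in> root_set B \<and> y \<in> root_set C \<or> x \<in> root_set D \<and> y \<in> root_set A)"
      unfolding E_def by auto
    show ?thesis
    proof (cases "x = k \<or> y = k")
      case True
      then show ?thesis unfolding new mutate_def
        by (elim disjE) (simp_all add: arrQ kE rd disj_commute)
    next
      case False
      then have "arr (mutate k Q) x y
          = (of_bool ((x, y) \<in> E \<or> x \<in> root_set A \<and> y \<in> root_set B \<or> x \<in> root_set C \<and> y \<in> root_set D)
              + of_bool (x \<in> root_set B \<or> x \<in> root_set D) * of_bool (y \<in> root_set A \<or> y \<in> root_set C))
            - (of_bool ((y, x) \<in> E \<or> y \<in> root_set A \<and> x \<in> root_set B \<or> y \<in> root_set C \<and> x \<in> root_set D)
              + of_bool (y \<in> root_set B \<or> y \<in> root_set D) * of_bool (x \<in> root_set A \<or> x \<in> root_set C))"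
        by (simp add: mutate_def arrQ kE rd)
      also have "\<dots> = of_bool ((x, y) \<in> E \<or> x \<in> root_set B \<and> y \<in> root_set C
          \<or> x \<in> root_set D \<and> y \<in> root_set A)"
        by (rule mutation_count; (rule asym' rdx | (rule impI, elim conjE, rule cross' cross'[THEN cross_swap]; assumption)))
      finally show ?thesis using False by (simp only: new) simp
    qed
  qed
  then show ?thesis
  proof (rule focusI[rotated -1])
    show "verts (mutate k Q) = set_tree (Node B k C) \<union> set_tree (Node D k A)"
      using focus_verts[OF assms] unfolding mutate_def by auto
    show "(set_tree B \<union> set_tree C) \<inter> (set_tree D \<union> set_tree A) = {}"
      by (simp add: Int_Un_distrib Int_Un_distrib2 d d(5-10)[THEN trans[OF Int_commute]])
  qed (simp_all add: d d(5-10)[THEN trans[OF Int_commute]])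
qed

lemma tree_like_mutate:
  assumes "tree_like Q" "k \<in> verts Q"
  shows "tree_like (mutate k Q)"
proof -
  obtain A B C D where "focus Q k A B C D" using tree_like_focus[OF assms] .
  then have "focus (mutate k Q) k B C D A" by (rule focus_mutate)
  then show ?thesis unfolding tree_like_def by (intro exI)
qed

lemma tree_like_mutations: "mutation_step\<^sup>*\<^sup>* Q Q' \<Longrightarrow> tree_like Q \<Longrightarrow> tree_like Q'"
  by (induction rule: rtranclp_induct) (auto simp: mutation_step_def intro: tree_like_mutate)

lemma verts_mutations: "mutation_step\<^sup>*\<^sup>* Q Q' \<Longrightarrow> verts Q' = verts Q"
  by (induction rule: rtranclp_induct) (auto simp: mutation_step_def mutate_def)

text \<open>The tree is built from the far end of the line: the rest of the line becomes the left
  child of \<open>f n\<close> if the arrow between \<open>f n\<close> and \<open>f (Suc n)\<close>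
  leaves \<open>f n\<close>, and the right child if it enters \<open>f n\<close>.\<close>

lemma linear_tree:
  fixes f :: "nat \<Rightarrow> 'v"
  assumes "inj_on f {1..k}" "1 \<le> i" "i \<le> k"
    and "\<forall>i\<in>{1..<k}. arr Q (f i) (f (Suc i)) + arr Q (f (Suc i)) (f i) = 1"
  shows "\<exists>t. uniq t \<and> root_set t = {f i} \<and> set_tree t = f ` {i..k} \<and>
    (\<forall>u v. (u, v) \<in> arrows t \<longleftrightarrow> (\<exists>j\<in>{i..<k}. arr Q u v > 0 \<and> {u, v} = {f j, f (Suc j)}))"
  using assms(3,2)
proof (induction i rule: inc_induct)
  case base
  show ?case by (rule exI[of _ "Node Leaf (f k) Leaf"]) auto
next
  case (step n)
  obtain t where t: "uniq t" "root_set t = {f (Suc n)}" "set_tree t = f ` {Suc n..k}"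
    "\<And>u v. (u, v) \<in> arrows t \<longleftrightarrow> (\<exists>j\<in>{Suc n..<k}. arr Q u v > 0 \<and> {u, v} = {f j, f (Suc j)})"
    using step by auto
  have new: "f n \<notin> f ` {Suc n..k}"
  proof
    assume "f n \<in> f ` {Suc n..k}"
    then obtain x where "f n = f x" "x \<in> {Suc n..k}" by blast
    then show False using inj_onD[OF assms(1), of n x] step.hyps assms(2) by auto
  qed
  have e: "arr Q (f n) (f (Suc n)) + arr Q (f (Suc n)) (f n) = 1" using assms(2,4) step.hyps by auto
  have ivl: "{n..<k} = insert n {Suc n..<k}" "{n..k} = insert n {Suc n..k}" using step by auto
  have ne: "f n \<noteq> f (Suc n)" using new step.hyps by auto
  have split: "(\<exists>j\<in>{n..<k}. arr Q u v > 0 \<and> {u, v} = {f j, f (Suc j)}) \<longleftrightarrow>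
      (u, v) \<in> arrows t \<or> arr Q u v > 0 \<and> {u, v} = {f n, f (Suc n)}" for u v
    unfolding t(4) ivl(1) by blast
  have new': "uniq (Node t (f n) Leaf)" "uniq (Node Leaf (f n) t)"
    using t(1,3) new by simp_all
  have set': "set_tree (Node t (f n) Leaf) = f ` {n..k}" "set_tree (Node Leaf (f n) t) = f ` {n..k}"
    unfolding ivl(2) using t(3) by simp_all
  show ?case
  proof (cases "arr Q (f n) (f (Suc n)) > 0")
    case True
    then have "arr Q (f (Suc n)) (f n) = 0" using e by simp
    then have "arr Q u v > 0 \<and> {u, v} = {f n, f (Suc n)} \<longleftrightarrow> u = f n \<and> v = f (Suc n)" for u v
      using True unfolding doubleton_eq_iff by auto
    moreover have "(u, v) \<in> arrows (Node t (f n) Leaf) \<longleftrightarrow>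
        (u, v) \<in> arrows t \<or> u = f n \<and> v = f (Suc n)" for u v
      by (simp add: t(2) disj_commute)
    ultimately have "(u, v) \<in> arrows (Node t (f n) Leaf) \<longleftrightarrow>
        (\<exists>j\<in>{n..<k}. arr Q u v > 0 \<and> {u, v} = {f j, f (Suc j)})" for u v
      unfolding split by simp
    then show ?thesis using new'(1) set'(1) by (intro exI[of _ "Node t (f n) Leaf"]) simp
  next
    case False
    then have "arr Q (f n) (f (Suc n)) = 0" "arr Q (f (Suc n)) (f n) > 0" using e by simp_all
    then have "arr Q u v > 0 \<and> {u, v} = {f n, f (Suc n)} \<longleftrightarrow> u = f (Suc n) \<and> v = f n" for u v
      unfolding doubleton_eq_iff by auto
    moreover have "(u, v) \<in> arrows (Node Leaf (f n) t) \<longleftrightarrow>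
        (u, v) \<in> arrows t \<or> u = f (Suc n) \<and> v = f n" for u v
      by (simp add: t(2) disj_commute)
    ultimately have "(u, v) \<in> arrows (Node Leaf (f n) t) \<longleftrightarrow>
        (\<exists>j\<in>{n..<k}. arr Q u v > 0 \<and> {u, v} = {f j, f (Suc j)})" for u v
      unfolding split by simp
    then show ?thesis using new'(2) set'(2) by (intro exI[of _ "Node Leaf (f n) t"]) simp
  qed
qed

text \<open>The tree of a linear quiver is rooted at one end of the line, so the second side of the
  focus there is empty. Tree-likeness is then carried along the mutations, which also keep the
  vertex set.\<close>

lemma mutation_type_A_tree_like:
  assumes "mutation_type_A k Q" "k \<ge> 1"
  shows "tree_like Q" "card (verts Q) = k"
proof -
  obtain Q0 f where Q0: "wf_quiver Q0" "mutation_step\<^sup>*\<^sup>* Q0 Q" "bij_betw f {1..k} (verts Q0)"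
    and e: "\<forall>i\<in>{1..k}. \<forall>j\<in>{1..k}. edges Q0 (f i) (f j) = (if A_joined i j then 1 else 0)"
    using assms(1) unfolding mutation_type_def has_underlying_graph_def by blast
  show "card (verts Q) = k"
    using verts_mutations[OF Q0(2)] bij_betw_same_card[OF Q0(3)] by simp
  have inj: "inj_on f {1..k}" and im: "f ` {1..k} = verts Q0"
    using Q0(3) unfolding bij_betw_def by auto
  have "\<forall>i\<in>{1..<k}. arr Q0 (f i) (f (Suc i)) + arr Q0 (f (Suc i)) (f i) = 1"
    using e unfolding edges_def A_joined_def by simp
  from linear_tree[OF inj _ assms(2) this]
  obtain t where t: "uniq t" "root_set t = {f 1}" "set_tree t = f ` {1..k}"
    "\<And>u v. (u, v) \<in> arrows t \<longleftrightarrow> (\<exists>j\<in>{1..<k}. arr Q0 u v > 0 \<and> {u, v} = {f j, f (Suc j)})"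
    by auto
  have "arr Q0 u v = of_bool ((u, v) \<in> arrows t)" for u v
  proof (cases "u \<in> verts Q0 \<and> v \<in> verts Q0")
    case True
    then obtain i j where ij: "u = f i" "v = f j" "i \<in> {1..k}" "j \<in> {1..k}" using im by blast
    have ed: "edges Q0 u v = (if A_joined i j then 1 else 0)" using e ij by auto
    have "(\<exists>j\<in>{1..<k}. {u, v} = {f j, f (Suc j)})" if "A_joined i j"
      using that ij unfolding A_joined_def
      by (metis Suc_eq_plus1 atLeastAtMost_iff atLeastLessThan_iff insert_commute less_eq_Suc_le)
    then have "arr Q0 u v > 0 \<longleftrightarrow> (u, v) \<in> arrows t"
      using t(4) ed unfolding edges_def by (auto split: if_splits)
    moreover have "arr Q0 u v \<le> 1" using ed unfolding edges_def by (auto split: if_splits)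
    ultimately show ?thesis by (cases "(u, v) \<in> arrows t") auto
  next
    case False
    then have "arr Q0 u v = 0" using Q0(1) unfolding wf_quiver_def by (metis not_gr0)
    then show ?thesis using t(4) by auto
  qed
  note a = this
  obtain l r where tn: "t = Node l (f 1) r" using t(2) by (cases t) auto
  have "focus Q0 (f 1) l r Leaf Leaf"
  proof (rule focusI)
    show "verts Q0 = set_tree (Node l (f 1) r) \<union> set_tree (Node Leaf (f 1) Leaf)"
      unfolding im[symmetric] t(3)[symmetric] tn by simp
  qed (use t(1) in \<open>simp_all add: a tn\<close>)
  then have "tree_like Q0" unfolding tree_like_def by (intro exI)
  with Q0(2) show "tree_like Q" by (rule tree_like_mutations)
qed

section \<open>Strings\<close>

lemma edges_commute: "edges Q x y = edges Q y x"
  by (simp add: edges_def)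

lemma three_cycle_distinct:
  assumes "wf_quiver Q" "{x, y, z} \<in> three_cycles Q"
  shows "x \<noteq> y" "x \<noteq> z" "y \<noteq> z"
proof -
  obtain a b c where abc: "{x, y, z} = {a, b, c}" "arr Q a b > 0" "arr Q b c > 0" "arr Q c a > 0"
    using assms(2) unfolding three_cycles_def by blast
  have "a \<noteq> b" "b \<noteq> c" "c \<noteq> a" using abc(2-4) assms(1) unfolding wf_quiver_def by (metis less_irrefl)+
  then have "card {x, y, z} = 3" unfolding abc(1) by simp
  then show "x \<noteq> y" "x \<noteq> z" "y \<noteq> z" by (auto simp: card_insert_if split: if_splits)
qed

lemma three_cycle_edges:
  assumes "{x, y, z} \<in> three_cycles Q" "wf_quiver Q"
  shows "edges Q x y > 0" "edges Q x z > 0" "edges Q y z > 0"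
proof -
  have *: "edges Q u v > 0" if uv: "u \<in> T" "v \<in> T" "u \<noteq> v" and T: "T \<in> three_cycles Q" for u v T
  proof -
    obtain a b c where "T = {a, b, c}" "arr Q a b > 0" "arr Q b c > 0" "arr Q c a > 0"
      using T unfolding three_cycles_def by blast
    then show ?thesis using uv by (auto simp: edges_def)
  qed
  show "edges Q x y > 0" "edges Q x z > 0" "edges Q y z > 0"
    using *[OF _ _ _ assms(1)] three_cycle_distinct[OF assms(2,1)] by simp_all
qed

text \<open>\<open>P\<close> contains the neighbours of the root outside the tree; no other vertex of the tree has any.\<close>

definition hangs :: "'v quiver \<Rightarrow> 'v tree \<Rightarrow> 'v set \<Rightarrow> bool" where
  "hangs Q t P \<longleftrightarrow> uniq t \<and> set_tree t \<subseteq> verts Q \<and> P \<inter> set_tree t = {} \<and>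
     (\<forall>v\<in>set_tree t. \<forall>w. edges Q v w > 0 \<longrightarrow> w \<in> set_tree t \<or> v \<in> root_set t \<and> w \<in> P) \<and>
     (\<forall>v\<in>set_tree t. \<forall>w\<in>set_tree t. arr Q v w = of_bool ((v, w) \<in> arrows t))"

lemma hangsD:
  assumes "hangs Q t P"
  shows "uniq t" "set_tree t \<subseteq> verts Q" "P \<inter> set_tree t = {}"
    "v \<in> set_tree t \<Longrightarrow> edges Q v w > 0 \<Longrightarrow> w \<in> set_tree t \<or> v \<in> root_set t \<and> w \<in> P"
    "v \<in> set_tree t \<Longrightarrow> w \<in> set_tree t \<Longrightarrow> arr Q v w = of_bool ((v, w) \<in> arrows t)"
  using assms unfolding hangs_def by metis+

text \<open>The part of the quiver near a node of the tree, in a form that is symmetric in the two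
  children.\<close>

definition fork :: "'v quiver \<Rightarrow> 'v \<Rightarrow> 'v tree \<Rightarrow> 'v tree \<Rightarrow> bool" where
  "fork Q x s t \<longleftrightarrow> hangs Q s (insert x (root_set t)) \<and> hangs Q t (insert x (root_set s)) \<and>
     x \<in> verts Q \<and> x \<notin> set_tree s \<and> x \<notin> set_tree t \<and> set_tree s \<inter> set_tree t = {} \<and>
     (\<forall>w\<in>set_tree s. edges Q x w = of_bool (w \<in> root_set s)) \<and>
     (\<forall>w\<in>set_tree t. edges Q x w = of_bool (w \<in> root_set t)) \<and>
     (\<forall>v\<in>set_tree s. \<forall>w\<in>set_tree t. edges Q v w = of_bool (v \<in> root_set s \<and> w \<in> root_set t)) \<and>
     (\<forall>v\<in>root_set s. \<forall>w\<in>root_set t. {x, v, w} \<in> three_cycles Q)"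

lemma forkD:
  assumes "fork Q x s t"
  shows "hangs Q s (insert x (root_set t))" "hangs Q t (insert x (root_set s))"
    "x \<in> verts Q" "x \<notin> set_tree s" "x \<notin> set_tree t" "set_tree s \<inter> set_tree t = {}"
    "w \<in> set_tree s \<Longrightarrow> edges Q x w = of_bool (w \<in> root_set s)"
    "w' \<in> set_tree t \<Longrightarrow> edges Q x w' = of_bool (w' \<in> root_set t)"
    "v \<in> set_tree s \<Longrightarrow> v' \<in> set_tree t \<Longrightarrow> edges Q v v' = of_bool (v \<in> root_set s \<and> v' \<in> root_set t)"
    "u \<in> root_set s \<Longrightarrow> u' \<in> root_set t \<Longrightarrow> {x, u, u'} \<in> three_cycles Q"
  using assms unfolding fork_def by simp_all

lemma fork_commute: "fork Q x s t \<Longrightarrow> fork Q x t s"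
proof -
  assume f: "fork Q x s t"
  note fD = forkD[OF f]
  have "edges Q v w = of_bool (v \<in> root_set t \<and> w \<in> root_set s)"
    if "v \<in> set_tree t" "w \<in> set_tree s" for v w
    using fD(9)[OF that(2,1)] by (simp add: edges_commute conj_commute)
  moreover have "{x, v, w} \<in> three_cycles Q" if "v \<in> root_set t" "w \<in> root_set s" for v w
    using fD(10)[OF that(2,1)] by (simp add: insert_commute)
  moreover have "set_tree t \<inter> set_tree s = {}" using fD(6) by (simp add: Int_commute)
  ultimately show ?thesis unfolding fork_def using fD(1-5,7,8) by simp
qed

text \<open>The root and the two subtrees are disjoint, so an arrow between two given blocks can
  come from only one summand of \<open>arrows (Node l x r)\<close>; each block pair is settled by
  picking out that summand.\<close>

lemma hangs_fork:
  assumes h: "hangs Q (Node l x r) P"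
  shows "fork Q x l r"
proof -
  have u: "uniq l" "uniq r" "x \<notin> set_tree l" "x \<notin> set_tree r" "set_tree l \<inter> set_tree r = {}"
    using hangsD(1)[OF h] by simp_all
  have sub: "insert x (set_tree l \<union> set_tree r) \<subseteq> verts Q" using hangsD(2)[OF h] by simp
  note rs = root_set_subset[of l] root_set_subset[of r]
  note asub = arrows_subset[of l] arrows_subset[of r]
  have a: "arr Q v w = of_bool ((v, w) \<in> arrows (Node l x r))"
    if "v \<in> insert x (set_tree l \<union> set_tree r)" "w \<in> insert x (set_tree l \<union> set_tree r)" for v w
    using hangsD(5)[OF h] that by simp
  have al: "arr Q v w = of_bool ((v, w) \<in> arrows l)" if "v \<in> set_tree l" "w \<in> set_tree l" for v w
  proof -
    have "(v, w) \<in> arrows (Node l x r) \<longleftrightarrow> (v, w) \<in> arrows l" using that u(3,5) rs asub by auto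
    then show ?thesis using a[of v w] that by (simp del: arrows.simps)
  qed
  have ar: "arr Q v w = of_bool ((v, w) \<in> arrows r)" if "v \<in> set_tree r" "w \<in> set_tree r" for v w
  proof -
    have "(v, w) \<in> arrows (Node l x r) \<longleftrightarrow> (v, w) \<in> arrows r" using that u(4,5) rs asub by auto
    then show ?thesis using a[of v w] that by (simp del: arrows.simps)
  qed
  have axl: "arr Q x w = of_bool (w \<in> root_set l)" "arr Q w x = 0" if "w \<in> set_tree l" for w
  proof -
    have "(x, w) \<in> arrows (Node l x r) \<longleftrightarrow> w \<in> root_set l" "(w, x) \<notin> arrows (Node l x r)"
      using that u(3-5) rs asub by auto
    then show "arr Q x w = of_bool (w \<in> root_set l)" "arr Q w x = 0" 
      using a[of w x] a[of x w] that by (simp_all del: arrows.simps)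
  qed
  have axr: "arr Q w x = of_bool (w \<in> root_set r)" "arr Q x w = 0" if "w \<in> set_tree r" for w
  proof -
    have "(w, x) \<in> arrows (Node l x r) \<longleftrightarrow> w \<in> root_set r" "(x, w) \<notin> arrows (Node l x r)"
      using that u(3-5) rs asub by auto
    then show "arr Q w x = of_bool (w \<in> root_set r)" "arr Q x w = 0" 
      using a[of w x] a[of x w] that by (simp_all del: arrows.simps)
  qed
  have alr: "arr Q v w = of_bool (v \<in> root_set l \<and> w \<in> root_set r)" "arr Q w v = 0"
    if "v \<in> set_tree l" "w \<in> set_tree r" for v w
  proof -
    have "(v, w) \<in> arrows (Node l x r) \<longleftrightarrow> v \<in> root_set l \<and> w \<in> root_set r"
        "(w, v) \<notin> arrows (Node l x r)"
      using that u(3-5) rs asub by auto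
    then show "arr Q v w = of_bool (v \<in> root_set l \<and> w \<in> root_set r)" "arr Q w v = 0"
      using a[of v w] a[of w v] that by (simp_all del: arrows.simps)
  qed
  have e: "edges Q x w = of_bool (w \<in> root_set l)" if "w \<in> set_tree l" for w
    using axl[OF that] by (simp add: edges_def)
  have e': "edges Q x w = of_bool (w \<in> root_set r)" if "w \<in> set_tree r" for w
    using axr[OF that] by (simp add: edges_def)
  have e'': "edges Q v w = of_bool (v \<in> root_set l \<and> w \<in> root_set r)"
    if "v \<in> set_tree l" "w \<in> set_tree r" for v w
    using alr[OF that] by (simp add: edges_def)
  \<comment> \<open>A vertex of a child is not the root of the whole tree, so its neighbours stay
    inside that tree. Only the root of the child can have neighbours outside the child, namely
    \<open>x\<close> and the root of the sibling.\<close>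
  have nl: "w \<in> set_tree l \<or> v \<in> root_set l \<and> w \<in> insert x (root_set r)"
    if "v \<in> set_tree l" "edges Q v w > 0" for v w
  proof -
    have "v \<in> set_tree (Node l x r)" "v \<notin> root_set (Node l x r)" using that(1) u(3) by auto
    then have "w \<in> set_tree l \<or> w = x \<or> w \<in> set_tree r" using hangsD(4)[OF h _ that(2)] by auto
    then show ?thesis
    proof (elim disjE)
      assume "w = x" then show ?thesis using e[OF that(1)] that(2) by (simp add: edges_commute)
    next
      assume "w \<in> set_tree r" then show ?thesis using e''[OF that(1)] that(2) by simp
    qed simp
  qed
  have nr: "w \<in> set_tree r \<or> v \<in> root_set r \<and> w \<in> insert x (root_set l)"
    if "v \<in> set_tree r" "edges Q v w > 0" for v w
  proof -
    have "v \<in> set_tree (Node l x r)" "v \<notin> root_set (Node l x r)" using that(1) u(4) by auto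
    then have "w \<in> set_tree l \<or> w = x \<or> w \<in> set_tree r" using hangsD(4)[OF h _ that(2)] by auto
    then show ?thesis
    proof (elim disjE)
      assume "w = x" then show ?thesis using e'[OF that(1)] that(2) by (simp add: edges_commute)
    next
      assume "w \<in> set_tree l"
      then show ?thesis using e''[OF _ that(1), of w] that(2) by (simp add: edges_commute)
    qed simp
  qed
  have hl: "hangs Q l (insert x (root_set r))"
    unfolding hangs_def
  proof (intro conjI ballI allI impI)
    show "insert x (root_set r) \<inter> set_tree l = {}" using u rs by auto
  qed (use u sub al nl in auto)
  have hr: "hangs Q r (insert x (root_set l))"
    unfolding hangs_def
  proof (intro conjI ballI allI impI)
    show "insert x (root_set l) \<inter> set_tree r = {}" using u rs by auto
  qed (use u sub ar nr in auto)
  have "{x, v, w} \<in> three_cycles Q" if "v \<in> root_set l" "w \<in> root_set r" for v w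
  proof -
    have vw: "v \<in> set_tree l" "w \<in> set_tree r" using that rs by auto
    then have "arr Q x v > 0" "arr Q v w > 0" "arr Q w x > 0"
      using axl(1)[of v] alr(1)[of v w] axr(1)[of w] that by simp_all
    then show ?thesis unfolding three_cycles_def by blast
  qed
  then show ?thesis
    unfolding fork_def using hl hr u sub e e' e'' by simp
qed

text \<open>Such a path may stop at any node, not only at a leaf.\<close>

inductive tree_path :: "'v tree \<Rightarrow> 'v list \<Rightarrow> bool" where
  root: "tree_path (Node l x r) [x]"
| left: "tree_path l q \<Longrightarrow> tree_path (Node l x r) (x # q)"
| right: "tree_path r q \<Longrightarrow> tree_path (Node l x r) (x # q)"

lemma tree_path_set: "tree_path t q \<Longrightarrow> q \<noteq> [] \<and> set q \<subseteq> set_tree t \<and> hd q \<in> root_set t"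
  by (induction rule: tree_path.induct) auto

lemma tree_path_distinct: "tree_path t q \<Longrightarrow> uniq t \<Longrightarrow> distinct q"
  by (induction rule: tree_path.induct) (use tree_path_set in fastforce)+

lemma tree_path_exists: "w \<in> set_tree t \<Longrightarrow> \<exists>q. tree_path t q \<and> last q = w"
proof (induction t)
  case (Node l x r)
  consider "w = x" | "w \<in> set_tree l" | "w \<in> set_tree r" using Node.prems by auto
  then show ?case
  proof cases
    case 1 then show ?thesis using tree_path.root[of l x r] by (intro exI[of _ "[x]"]) simp
  next
    case 2
    then obtain q where "tree_path l q" "last q = w" using Node.IH(1) by blast
    then show ?thesis using tree_path_set[of l q] tree_path.left by (intro exI[of _ "x # q"]) simp
  next
    case 3
    then obtain q where "tree_path r q" "last q = w" using Node.IH(2) by blast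
    then show ?thesis using tree_path_set[of r q] tree_path.right by (intro exI[of _ "x # q"]) simp
  qed
qed simp

lemma is_string_single: "is_string Q [x] \<longleftrightarrow> x \<in> verts Q"
  by (simp add: is_string_def)

lemma is_string_Cons: "is_string Q (x # y # q) \<longleftrightarrow> x \<in> verts Q \<and> edges Q x y > 0 \<and>
    is_string Q (y # q) \<and> (q \<noteq> [] \<longrightarrow> x \<noteq> hd q \<and> {x, y, hd q} \<notin> three_cycles Q)"
proof -
  \<comment> \<open>This peels off index 0 from a condition on positions \<open>i\<close>,
    \<open>i + 1\<close>, \<open>i + k\<close>. It serves with \<open>k = 1\<close> for the edges
    and with \<open>k = 2\<close> for the other two conditions on strings.\<close>
  have split: "(\<forall>i. i + k < length (x # y # q) \<longrightarrow> R ((x # y # q) ! i) ((x # y # q) ! (i + 1)) ((x # y # q) ! (i + k)))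
     \<longleftrightarrow> (k < length (x # y # q) \<longrightarrow> R x y ((x # y # q) ! k)) \<and>
     (\<forall>i. i + k < length (y # q) \<longrightarrow> R ((y # q) ! i) ((y # q) ! (i + 1)) ((y # q) ! (i + k)))" (is "?A \<longleftrightarrow> ?B")
    if "k \<ge> 1" for k and R :: "'a \<Rightarrow> 'a \<Rightarrow> 'a \<Rightarrow> bool"
  proof
    assume A: ?A
    show ?B
    proof (intro conjI allI impI)
      assume "k < length (x # y # q)" then show "R x y ((x # y # q) ! k)" using A[rule_format, of 0] by simp
    next
      fix i assume "i + k < length (y # q)"
      then show "R ((y # q) ! i) ((y # q) ! (i + 1)) ((y # q) ! (i + k))"
        using A[rule_format, of "Suc i"] by simp
    qed
  next
    assume B: ?B
    show ?A
    proof (intro allI impI)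
      fix i assume i: "i + k < length (x # y # q)"
      show "R ((x # y # q) ! i) ((x # y # q) ! (i + 1)) ((x # y # q) ! (i + k))"
      proof (cases i)
        case 0 then show ?thesis using B i by simp
      next
        case (Suc j) then show ?thesis using B i by simp
      qed
    qed
  qed
  have 2: "(2 < length (x # y # q) \<longrightarrow> S ((x # y # q) ! 2)) \<longleftrightarrow> (q \<noteq> [] \<longrightarrow> S (hd q))" for S
    by (cases q) simp_all
  show ?thesis
    unfolding is_string_def
    using split[of 1 "\<lambda>a b c. edges Q a b > 0"] split[of 2 "\<lambda>a b c. a \<noteq> c"]
      split[of 2 "\<lambda>a b c. {a, b, c} \<notin> three_cycles Q"] 2[of "\<lambda>c. x \<noteq> c"]
      2[of "\<lambda>c. {x, y, c} \<notin> three_cycles Q"]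
    by auto
qed

text \<open>A string that does not leave the tree at its first step can only descend. From a child
  it cannot return to the parent, because it is reduced, nor pass to the sibling, because parent,
  child and sibling form a 3-cycle. These two vertices are the set \<open>P\<close> of the child, so
  the premise on the second vertex is preserved.\<close>

lemma string_is_tree_path:
  assumes "wf_quiver Q" "hangs Q t P" "is_string Q q" "hd q \<in> root_set t"
    and "length q > 1 \<Longrightarrow> q ! 1 \<notin> P"
  shows "tree_path t q"
  using assms(2-)
proof (induction t arbitrary: P q)
  case (Node l x r)
  have ne: "q \<noteq> []" using Node.prems(2) by (simp add: is_string_def)
  have hd: "hd q = x" using Node.prems(3) by simp
  have fk: "fork Q x l r" by (rule hangs_fork[OF Node.prems(1)])
  show ?case
  proof (cases "tl q")
    case Nil
    then have "q = [x]" using ne hd by (cases q) simp_all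
    then show ?thesis using tree_path.root by simp
  next
    case (Cons y q')
    then have q: "q = x # y # q'" using ne hd by (cases q) simp_all
    note str = Node.prems(2)[unfolded q is_string_Cons]
    have "y \<notin> P" using Node.prems(4) q by simp
    then have "y \<in> set_tree (Node l x r)" using hangsD(4)[OF Node.prems(1), of x y] str by simp
    moreover have "y \<noteq> x" using str assms(1) by (auto simp: edges_def wf_quiver_def)
    ultimately consider "y \<in> set_tree l" | "y \<in> set_tree r" by auto
    then show ?thesis
    proof cases
      case 1
      have y: "y \<in> root_set l"
        using forkD(7)[OF fk 1] str by (auto split: if_splits simp: of_bool_def)
      have "tree_path l (y # q')"
      proof (rule Node.IH(1)[OF forkD(1)[OF fk]])
        show "(y # q') ! 1 \<notin> insert x (root_set r)" if "length (y # q') > 1"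
          using that str forkD(10)[OF fk y] by (cases q') auto
      qed (use str y in auto)
      then show ?thesis unfolding q by (rule tree_path.left)
    next
      case 2
      have y: "y \<in> root_set r"
        using forkD(8)[OF fk 2] str by (auto split: if_splits simp: of_bool_def)
      have "tree_path r (y # q')"
      proof (rule Node.IH(2)[OF forkD(2)[OF fk]])
        show "(y # q') ! 1 \<notin> insert x (root_set l)" if "length (y # q') > 1"
          using that str forkD(10)[OF fk _ y] by (cases q') (auto simp: insert_commute)
      qed (use str y in auto)
      then show ?thesis unfolding q by (rule tree_path.right)
    qed
  qed
qed simp

text \<open>The second vertex of \<open>q\<close> lies in \<open>s\<close> but is not its root, so
  it is not joined to \<open>x\<close>. Hence it neither equals \<open>x\<close> nor lies on a
  3-cycle with \<open>x\<close>.\<close>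

lemma fork_string:
  assumes "wf_quiver Q" "fork Q x s t" "tree_path s q" "is_string Q q"
  shows "is_string Q (x # q)"
proof -
  note q = tree_path_set[OF assms(3)]
  obtain y q' where yq: "q = y # q'" using q by (cases q) auto
  have y: "y \<in> root_set s" "y \<in> set_tree s" using q yq by auto
  have "x \<noteq> hd q' \<and> {x, y, hd q'} \<notin> three_cycles Q" if ne: "q' \<noteq> []"
  proof -
    have w: "hd q' \<in> set_tree s" using q yq ne by (cases q') auto
    have "distinct q" using tree_path_distinct[OF assms(3)] hangsD(1)[OF forkD(1)[OF assms(2)]] by blast
    then have "hd q' \<noteq> y" using yq ne by (cases q') auto
    then have "hd q' \<notin> root_set s" using y root_setD by metis
    then have "edges Q x (hd q') = 0" using forkD(7)[OF assms(2) w] by simp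
    then show ?thesis using three_cycle_edges(2)[OF _ assms(1)] w forkD(4)[OF assms(2)]
      by (metis less_irrefl)
  qed
  then show ?thesis
    using assms(4) forkD(3,7)[OF assms(2)] y unfolding yq is_string_Cons by simp
qed

lemma tree_path_is_string:
  assumes "wf_quiver Q" "tree_path t q" "hangs Q t P"
  shows "is_string Q q"
  using assms(2,3)
proof (induction arbitrary: P rule: tree_path.induct)
  case (root l x r)
  then show ?case using hangsD(2) by (fastforce simp: is_string_single)
next
  case (left l q x r)
  note fk = hangs_fork[OF left.prems]
  show ?case by (rule fork_string[OF assms(1) fk left.hyps left.IH[OF forkD(1)[OF fk]]])
next
  case (right r q l x)
  note fk = fork_commute[OF hangs_fork[OF right.prems]]
  show ?case by (rule fork_string[OF assms(1) fk right.hyps right.IH[OF forkD(1)[OF fk]]])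
qed

text \<open>The vertices \<open>x\<close> and \<open>y\<close> are the only possible neighbours of
  \<open>z\<close> outside \<open>t\<close>, so the strings from \<open>z\<close> that avoid both
  are the descending paths of \<open>t\<close>.\<close>

lemma fork_rooted_subquiver:
  assumes "wf_quiver Q" "fork Q x s t" "y \<in> root_set s" "z \<in> root_set t"
  shows "rooted_subquiver Q z x y = full_subquiver Q (set_tree t)"
proof -
  have h: "hangs Q t (insert x (root_set s))" by (rule forkD(2)[OF assms(2)])
  have rs: "root_set s = {y}" using assms(3) by (cases s) auto
  have "(\<exists>p. string_from_to Q z w p \<and> x \<notin> set p \<and> y \<notin> set p) \<longleftrightarrow> w \<in> set_tree t" for w
  proof
    assume "\<exists>p. string_from_to Q z w p \<and> x \<notin> set p \<and> y \<notin> set p"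
    then obtain p where p: "is_string Q p" "hd p = z" "last p = w" "x \<notin> set p" "y \<notin> set p"
      unfolding string_from_to_def by blast
    have "tree_path t p"
    proof (rule string_is_tree_path[OF assms(1) h p(1)])
      show "p ! 1 \<notin> insert x (root_set s)" if "length p > 1"
        using p(4,5) nth_mem[OF that] unfolding rs by auto
    qed (simp add: p(2) assms(4))
    then show "w \<in> set_tree t" using tree_path_set[of t p] p(3) last_in_set[of p] by auto
  next
    assume "w \<in> set_tree t"
    then obtain q where q: "tree_path t q" "last q = w" using tree_path_exists by metis
    note qs = tree_path_set[OF q(1)]
    have "hd q = z" using qs assms(4) root_setD by metis
    moreover have "is_string Q q" by (rule tree_path_is_string[OF assms(1) q(1) h])
    moreover have "x \<notin> set q" "y \<notin> set q"
      using qs forkD(5,6)[OF assms(2)] assms(3) root_set_subset[of s] by auto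
    ultimately show "\<exists>p. string_from_to Q z w p \<and> x \<notin> set p \<and> y \<notin> set p"
      unfolding string_from_to_def using q(2) by blast
  qed
  then show ?thesis unfolding rooted_subquiver_def by simp
qed

text \<open>This makes the rooted subquivers met in the labelling procedure tree-like again, with
  the complementary vertex at the root.\<close>

lemma hangs_full_subquiver:
  assumes "hangs Q (Node l z r) P"
  shows "focus (full_subquiver Q (set_tree (Node l z r))) z l r Leaf Leaf"
proof (rule focusI)
  fix v w
  have "arrows (Node Leaf z Leaf) = {}" by simp
  then show "arr (full_subquiver Q (set_tree (Node l z r))) v w
      = of_bool ((v, w) \<in> arrows (Node l z r) \<union> arrows (Node Leaf z Leaf))"
    using hangsD(5)[OF assms, of v w] arrows_subset[of "Node l z r"]
    by (auto simp: full_subquiver_def simp del: arrows.simps tree.set)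
qed (use hangsD(1,2)[OF assms] in \<open>auto simp: full_subquiver_def\<close>)

section \<open>End vertices\<close>

lemma focus_wf:
  assumes "focus Q k A B C D"
  shows "wf_quiver Q"
proof -
  define E where "E = arrows (Node A k B) \<union> arrows (Node C k D)"
  note d = focus_disjoint[OF assms]
  have u: "uniq (Node A k B)" "uniq (Node C k D)" using d by simp_all
  have v: "verts Q = set_tree (Node A k B) \<union> set_tree (Node C k D)"
    unfolding focus_verts[OF assms] by auto
  have a: "arr Q x y = of_bool ((x, y) \<in> E)" for x y
    unfolding E_def by (rule focus_arr[OF assms])
  have sub: "(x, y) \<in> arrows t \<Longrightarrow> x \<in> set_tree t \<and> y \<in> set_tree t" for t :: "'a tree" and x y
    using arrows_subset[of t] by auto
  \<comment> \<open>The two sides meet only in \<open>k\<close>, so opposite arrows taken from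
    different sides would both be loops at \<open>k\<close>.\<close>
  have int: "x = k" if "x \<in> set_tree (Node A k B)" "x \<in> set_tree (Node C k D)" for x
    using that d(6-9) by auto
  have "(x, x) \<notin> E" for x
    unfolding E_def using arrows_irrefl[OF u(1)] arrows_irrefl[OF u(2)] by simp
  moreover have "\<not> ((x, y) \<in> E \<and> (y, x) \<in> E)" for x y
  proof
    assume xy: "(x, y) \<in> E \<and> (y, x) \<in> E"
    consider "(x, y) \<in> arrows (Node A k B)" "(y, x) \<in> arrows (Node A k B)"
      | "(x, y) \<in> arrows (Node C k D)" "(y, x) \<in> arrows (Node C k D)"
      | "(x, y) \<in> arrows (Node A k B)" "(y, x) \<in> arrows (Node C k D)"
      | "(x, y) \<in> arrows (Node C k D)" "(y, x) \<in> arrows (Node A k B)"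
      using xy unfolding E_def by (elim conjE UnE) simp_all
    then show False
    proof cases
      case 1 then show ?thesis using arrows_asym[OF u(1)] by metis
    next
      case 2 then show ?thesis using arrows_asym[OF u(2)] by metis
    next
      case 3
      then have "x = k" "y = k" using sub int by metis+
      then show ?thesis using 3 arrows_irrefl[OF u(1)] by metis
    next
      case 4
      then have "x = k" "y = k" using sub int by metis+
      then show ?thesis using 4 arrows_irrefl[OF u(1)] by metis
    qed
  qed
  moreover have "x \<in> verts Q \<and> y \<in> verts Q" if "(x, y) \<in> E" for x y
    using that sub unfolding E_def v by (metis Un_iff)
  moreover have "finite (verts Q)" unfolding v by simp
  ultimately show ?thesis unfolding wf_quiver_def a by simp
qed

lemma card_neighbours_le_valency:
  assumes "wf_quiver Q" "finite S" "\<And>y. y \<in> S \<Longrightarrow> edges Q x y > 0"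
  shows "card S \<le> valency Q x"
proof -
  have "S \<subseteq> verts Q"
    using assms(1,3) unfolding wf_quiver_def edges_def by (metis add_gr_0 subsetI)
  have "card S = (\<Sum>y\<in>S. 1)" by simp
  also have "\<dots> \<le> (\<Sum>y\<in>S. edges Q x y)"
    by (rule sum_mono) (use assms(3) in \<open>simp add: Suc_leI\<close>)
  also have "\<dots> \<le> (\<Sum>y\<in>verts Q. edges Q x y)"
    using \<open>S \<subseteq> verts Q\<close> assms(1) by (intro sum_mono2) (simp_all add: wf_quiver_def)
  finally show ?thesis unfolding valency_def .
qed

text \<open>Two distinct neighbours force valency 2 and a 3-cycle through \<open>x\<close>; the
  other two vertices of that cycle already exhaust the valency, so they are \<open>u\<close> and
  \<open>v\<close>.\<close>

lemma end_vertex_neighbours: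
  assumes "wf_quiver Q" "end_vertex Q x" "edges Q x u > 0" "edges Q x v > 0" "u \<noteq> v"
  shows "edges Q u v > 0"
proof -
  have "card {u, v} \<le> valency Q x"
    by (rule card_neighbours_le_valency[OF assms(1)]) (use assms in auto)
  then have "valency Q x \<ge> 2" using assms(5) by simp
  then obtain T where val: "valency Q x = 2" and T: "T \<in> three_cycles Q" "x \<in> T"
    using assms(2) unfolding end_vertex_def by auto
  then obtain p q where pq: "T = {x, p, q}"
    unfolding three_cycles_def by (auto simp: insert_commute)
  have pq': "{x, p, q} \<in> three_cycles Q" using T(1) pq by simp
  note ed = three_cycle_edges[OF pq' assms(1)]
  have "p \<noteq> q" by (rule three_cycle_distinct[OF assms(1) pq'])
  have "w \<in> {p, q}" if "edges Q x w > 0" for w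
  proof (rule ccontr)
    assume "w \<notin> {p, q}"
    then have "card {w, p, q} = 3" using \<open>p \<noteq> q\<close> by simp
    moreover have "card {w, p, q} \<le> valency Q x"
      by (rule card_neighbours_le_valency[OF assms(1)]) (use ed that in auto)
    ultimately show False using val by simp
  qed
  then have "{u, v} = {p, q}" using assms(3-5) by blast
  then show ?thesis using ed(3) by (metis doubleton_eq_iff edges_commute)
qed

text \<open>If both sides of \<open>e\<close> were nonempty, a neighbour on one side would be joined
  to a neighbour on the other side, but no arrow runs between vertices other than \<open>e\<close>
  on opposite sides.\<close>

lemma end_vertex_focus:
  assumes "tree_like Q" "end_vertex Q e"
  obtains l r where "focus Q e l r Leaf Leaf"
proof -
  have "e \<in> verts Q" using assms(2) unfolding end_vertex_def by simp
  then obtain A B C D where f: "focus Q e A B C D" using tree_like_focus[OF assms(1)] by metis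
  note d = focus_disjoint[OF f]
  note rs = root_set_subset[of A] root_set_subset[of B] root_set_subset[of C] root_set_subset[of D]
  have "A = Leaf \<and> B = Leaf \<or> C = Leaf \<and> D = Leaf"
  proof (rule ccontr)
    assume n: "\<not> ?thesis"
    have "root_set t \<noteq> {}" if "t \<noteq> Leaf" for t :: "'a tree" using that by (cases t) simp_all
    then have "root_set A \<union> root_set B \<noteq> {}" "root_set C \<union> root_set D \<noteq> {}" using n by auto
    then obtain u v where uv: "u \<in> root_set A \<union> root_set B" "v \<in> root_set C \<union> root_set D" by blast
    have uv': "u \<in> set_tree A \<union> set_tree B" "v \<in> set_tree C \<union> set_tree D" using uv rs by auto
    then have ne: "u \<noteq> v" "u \<notin> set_tree (Node C e D)" "v \<notin> set_tree (Node A e B)"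
      using d by auto
    have "(e, u) \<in> arrows (Node A e B) \<or> (u, e) \<in> arrows (Node A e B)"
      "(e, v) \<in> arrows (Node C e D) \<or> (v, e) \<in> arrows (Node C e D)" using uv by auto
    then have "edges Q e u > 0" "edges Q e v > 0"
      unfolding edges_def focus_arr[OF f] by (auto simp del: arrows.simps)
    then have "edges Q u v > 0"
      by (rule end_vertex_neighbours[OF focus_wf[OF f] assms(2) _ _ ne(1)])
    moreover have "edges Q u v = 0"
      unfolding edges_def focus_arr[OF f]
      using ne(2,3) arrows_subset[of "Node A e B"] arrows_subset[of "Node C e D"]
      by (auto simp del: arrows.simps tree.set)
    ultimately show False by simp
  qed
  then show thesis using that f focus_swap[OF f] by metis
qed

lemma focus_hangs:
  assumes "focus Q e l r Leaf Leaf"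
  shows "hangs Q (Node l e r) {}" "verts Q = set_tree (Node l e r)"
proof -
  have v: "verts Q = set_tree (Node l e r)" using focus_verts[OF assms] by auto
  have w: "wf_quiver Q" by (rule focus_wf[OF assms])
  have "arrows (Node Leaf e Leaf) = {}" by simp
  then have a: "arr Q x y = of_bool ((x, y) \<in> arrows (Node l e r))" for x y
    using focus_arr[OF assms, of x y] by (simp del: arrows.simps)
  have "y \<in> verts Q" if "edges Q x y > 0" for x y
    using that w unfolding wf_quiver_def edges_def by (metis add_gr_0)
  then have nb: "edges Q x y > 0 \<Longrightarrow> y \<in> verts Q" for x y .
  show "hangs Q (Node l e r) {}"
    unfolding hangs_def v[symmetric]
  proof (intro conjI ballI allI impI)
    show "uniq (Node l e r)" using focus_disjoint[OF assms] by simp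
  qed (use nb in \<open>simp_all add: a del: arrows.simps\<close>)
  show "verts Q = set_tree (Node l e r)" by (rule v)
qed

section \<open>The type A labelling\<close>

text \<open>\<open>V\<close> carries the labels \<open>k + 1, \<dots>, k + card V\<close>, and \<open>Z\<close> holds the vertex labelled last
  (\<open>Z\<close> and \<open>V\<close> may both be empty).  The value \<open>s x\<close> is the index of the second coordinate of the
  vector \<open>\<epsilon>\<^bsub>L x\<^esub> - \<epsilon>\<^bsub>s x\<^esub>\<close> attached to \<open>x\<close>.\<close>

definition good_labelling ::
  "'v quiver \<Rightarrow> 'v set \<Rightarrow> ('v \<Rightarrow> nat) \<Rightarrow> nat \<Rightarrow> 'v set \<Rightarrow> ('v \<Rightarrow> nat) \<Rightarrow> bool" where
  "good_labelling Q V L k Z s \<longleftrightarrow> finite V \<and> bij_betw L V {k<..k + card V} \<and> Z \<subseteq> V \<and>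
     (\<forall>z\<in>Z. L z = k + card V) \<and>
     (\<forall>v\<in>V. L v < s v \<and> s v \<le> Suc (k + card V) \<and> (s v = Suc (k + card V) \<longleftrightarrow> v \<in> Z)) \<and>
     (\<forall>v\<in>V. \<forall>w\<in>V. v \<noteq> w \<longrightarrow> edges Q v w = of_bool (s v = L w \<or> s w = L v \<or> s v = s w)) \<and>
     (\<forall>u\<in>V. \<forall>v\<in>V. \<forall>w\<in>V. {u, v, w} \<in> three_cycles Q \<longrightarrow> L u < L v \<longrightarrow> L v < L w \<longrightarrow>
        L w = Suc (L v) \<and> s u = L w) \<and>
     (\<forall>u\<in>V. (\<forall>v\<in>V. \<forall>w\<in>V. {u, v, w} \<in> three_cycles Q \<longrightarrow> L u < L v \<longrightarrow> \<not> L v < L w) \<longrightarrow>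
        s u = Suc (L u))"

lemma good_labellingD:
  assumes "good_labelling Q V L k Z s"
  shows "finite V" "bij_betw L V {k<..k + card V}" "Z \<subseteq> V"
    "z \<in> Z \<Longrightarrow> L z = k + card V"
    "v \<in> V \<Longrightarrow> L v < s v" "v \<in> V \<Longrightarrow> s v \<le> Suc (k + card V)"
    "v \<in> V \<Longrightarrow> s v = Suc (k + card V) \<longleftrightarrow> v \<in> Z"
    "v \<in> V \<Longrightarrow> k < L v" "v \<in> V \<Longrightarrow> L v \<le> k + card V"
    "v \<in> V \<Longrightarrow> w \<in> V \<Longrightarrow> v \<noteq> w \<Longrightarrow>
      edges Q v w = of_bool (s v = L w \<or> s w = L v \<or> s v = s w)"
    "u \<in> V \<Longrightarrow> v \<in> V \<Longrightarrow> w \<in> V \<Longrightarrow> {u, v, w} \<in> three_cycles Q \<Longrightarrow> L u < L v \<Longrightarrow> L v < L w \<Longrightarrow>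
      L w = Suc (L v) \<and> s u = L w"
    "u \<in> V \<Longrightarrow> (\<And>v w. v \<in> V \<Longrightarrow> w \<in> V \<Longrightarrow> {u, v, w} \<in> three_cycles Q \<Longrightarrow> L u < L v \<Longrightarrow> \<not> L v < L w)
      \<Longrightarrow> s u = Suc (L u)"
proof -
  note a = assms[unfolded good_labelling_def]
  have range: "\<forall>v\<in>V. L v < s v \<and> s v \<le> Suc (k + card V) \<and> (s v = Suc (k + card V) \<longleftrightarrow> v \<in> Z)"
    and last: "\<forall>z\<in>Z. L z = k + card V"
    and edge: "\<forall>v\<in>V. \<forall>w\<in>V. v \<noteq> w \<longrightarrow> edges Q v w = of_bool (s v = L w \<or> s w = L v \<or> s v = s w)"
    and cycle: "\<forall>u\<in>V. \<forall>v\<in>V. \<forall>w\<in>V. {u, v, w} \<in> three_cycles Q \<longrightarrow> L u < L v \<longrightarrow> L v < L w \<longrightarrow>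
        L w = Suc (L v) \<and> s u = L w"
    and other: "\<forall>u\<in>V. (\<forall>v\<in>V. \<forall>w\<in>V. {u, v, w} \<in> three_cycles Q \<longrightarrow> L u < L v \<longrightarrow> \<not> L v < L w)
        \<longrightarrow> s u = Suc (L u)"
    using a by - (elim conjE, assumption)+
  show "finite V" and bij: "bij_betw L V {k<..k + card V}" and "Z \<subseteq> V"
    using a by - (elim conjE, assumption)+
  show "v \<in> V \<Longrightarrow> k < L v" "v \<in> V \<Longrightarrow> L v \<le> k + card V"
    using bij_betwE[OF bij] by auto
  show "z \<in> Z \<Longrightarrow> L z = k + card V" using last by blast
  show "v \<in> V \<Longrightarrow> L v < s v" "v \<in> V \<Longrightarrow> s v \<le> Suc (k + card V)"
    "v \<in> V \<Longrightarrow> s v = Suc (k + card V) \<longleftrightarrow> v \<in> Z"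
    using range by blast+
  show "v \<in> V \<Longrightarrow> w \<in> V \<Longrightarrow> v \<noteq> w \<Longrightarrow>
      edges Q v w = of_bool (s v = L w \<or> s w = L v \<or> s v = s w)"
    by (rule edge[rule_format])
  show "u \<in> V \<Longrightarrow> v \<in> V \<Longrightarrow> w \<in> V \<Longrightarrow> {u, v, w} \<in> three_cycles Q \<Longrightarrow> L u < L v \<Longrightarrow> L v < L w \<Longrightarrow>
      L w = Suc (L v) \<and> s u = L w"
    by (rule cycle[rule_format])
  show "u \<in> V \<Longrightarrow> (\<And>v w. v \<in> V \<Longrightarrow> w \<in> V \<Longrightarrow> {u, v, w} \<in> three_cycles Q \<Longrightarrow> L u < L v \<Longrightarrow> \<not> L v < L w)
      \<Longrightarrow> s u = Suc (L u)"
    by (rule other[rule_format])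
qed

text \<open>The labels run through \<open>x\<close>, then \<open>T\<close>, then \<open>S\<close>,
  and \<open>s x\<close> is set to \<open>L y = Suc k'\<close>. In \<open>T\<close>, exactly the
  vertex in \<open>Z\<close> has \<open>s\<close>-value \<open>Suc k'\<close>, the others have
  smaller ones; in \<open>S\<close> all \<open>s\<close>-values are larger. So \<open>x\<close>
  meets \<open>y\<close> through \<open>s x = L y\<close>, it meets \<open>z\<close> through
  \<open>s x = s z\<close>, and \<open>z\<close> meets \<open>y\<close> through
  \<open>s z = L y\<close>; no other coincidence arises across the blocks. If \<open>T\<close> is
  empty, then \<open>k' = k\<close> and \<open>s x = Suc (L x)\<close>, as required of a vertex that
  is not primary.\<close>

lemma good_labelling_join:
  assumes wf: "wf_quiver Q"
    and s1: "good_labelling Q S L k' {f} s1" and s2: "good_labelling Q T L k Z s2"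
    and x: "x \<notin> S" "x \<notin> T" "S \<inter> T = {}" "L x = k" "k > 0"
    and k': "k' = k + card T"
    and y: "y \<in> S" "L y = Suc k'" and Z: "Z = {} \<Longrightarrow> T = {}"
    and xS: "\<And>w. w \<in> S \<Longrightarrow> edges Q x w = of_bool (w = y)"
    and xT: "\<And>w. w \<in> T \<Longrightarrow> edges Q x w = of_bool (w \<in> Z)"
    and ST: "\<And>v w. v \<in> S \<Longrightarrow> w \<in> T \<Longrightarrow> edges Q v w = of_bool (v = y \<and> w \<in> Z)"
    and tri: "\<And>z. z \<in> Z \<Longrightarrow> {x, y, z} \<in> three_cycles Q"
  shows "\<exists>s. good_labelling Q (insert x (S \<union> T)) L (k - 1) {f} s"
proof -
  define s where "s = (\<lambda>v. if v = x then L y else if v \<in> S then s1 v else s2 v)"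
  define V where "V = insert x (S \<union> T)"
  note d1 = good_labellingD[OF s1] and d2 = good_labellingD[OF s2]
  have sx: "s x = Suc k'" unfolding s_def by (simp add: y)
  have sS: "s v = s1 v" if "v \<in> S" for v unfolding s_def using that x by auto
  have sT: "s v = s2 v" if "v \<in> T" for v unfolding s_def using that x by auto
  have cardV: "k - 1 + card V = k' + card S"
    unfolding V_def using d1(1) d2(1) x k' by (simp add: card_Un_disjoint)
  have LS: "k' < L v" "L v \<le> k' + card S" if "v \<in> S" for v using d1(8,9) that by auto
  have LT: "k < L v" "L v \<le> k'" if "v \<in> T" for v using d2(8,9) that k' by auto
  have inj1: "inj_on L S" and inj2: "inj_on L T" using d1(2) d2(2) by (auto simp: bij_betw_def)
  have yL: "v = y" if "v \<in> S" "L v = Suc k'" for v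
    using inj_onD[OF inj1] that y by simp
  have sTle: "s v \<le> Suc k'" "s v = Suc k' \<longleftrightarrow> v \<in> Z" if "v \<in> T" for v
    using d2(6,7)[OF that] sT[OF that] k' by simp_all
  have sgt: "L v < s v" if "v \<in> V" for v
    using that d1(5) d2(5) sS sT sx x k' unfolding V_def by auto
  have e_xS: "edges Q x w = of_bool (s x = L w \<or> s w = L x \<or> s x = s w)" if w: "w \<in> S" for w
  proof -
    have "s w > Suc k'" using sgt[of w] w LS(1)[OF w] unfolding V_def by simp
    then show ?thesis using xS[OF w] yL[OF w] sx y x k' by auto
  qed
  have e_xT: "edges Q x w = of_bool (s x = L w \<or> s w = L x \<or> s x = s w)" if w: "w \<in> T" for w
  proof -
    have "s w > k" using sgt[of w] w LT(1)[OF w] unfolding V_def by simp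
    then show ?thesis using xT[OF w] sTle[OF w] LT(2)[OF w] sx x by auto
  qed
  have e_ST: "edges Q v w = of_bool (s v = L w \<or> s w = L v \<or> s v = s w)"
    if v: "v \<in> S" and w: "w \<in> T" for v w
  proof -
    have "s v > Suc k'" using sgt[of v] v LS(1)[OF v] unfolding V_def by simp
    then have "s v \<noteq> L w" "s v \<noteq> s w" using LT(2)[OF w] sTle(1)[OF w] by auto
    moreover have "s w = L v \<longleftrightarrow> v = y \<and> w \<in> Z"
      using sTle[OF w] LS(1)[OF v] yL[OF v] y by (metis Suc_leI le_antisym)
    ultimately show ?thesis using ST[OF v w] by simp
  qed
  have sym: "(s v = L w \<or> s w = L v \<or> s v = s w) \<longleftrightarrow> (s w = L v \<or> s v = L w \<or> s w = s v)" for v w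
    by auto
  have edge: "edges Q v w = of_bool (s v = L w \<or> s w = L v \<or> s v = s w)"
    if vw: "v \<in> V" "w \<in> V" "v \<noteq> w" for v w
  proof -
    consider "v = x" "w \<in> S" | "v = x" "w \<in> T" | "w = x" "v \<in> S" | "w = x" "v \<in> T"
      | "v \<in> S" "w \<in> S" | "v \<in> T" "w \<in> T" | "v \<in> S" "w \<in> T" | "v \<in> T" "w \<in> S"
      using vw unfolding V_def by blast
    then show ?thesis
    proof cases
      case 1 then show ?thesis using e_xS by simp
    next
      case 2 then show ?thesis using e_xT by simp
    next
      case 3 then show ?thesis using e_xS[of v] sym[of v w] edges_commute[of Q v w] by simp
    next
      case 4 then show ?thesis using e_xT[of v] sym[of v w] edges_commute[of Q v w] by simp
    next
      case 5 then show ?thesis using d1(10) vw(3) sS by simp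
    next
      case 6 then show ?thesis using d2(10) vw(3) sT by simp
    next
      case 7 then show ?thesis using e_ST by simp
    next
      case 8 then show ?thesis using e_ST[of w v] sym[of v w] edges_commute[of Q v w] by simp
    qed
  qed
  have cyc: "L w = Suc (L v) \<and> s u = L w"
    if uV: "u \<in> V" "v \<in> V" "w \<in> V" and t: "{u, v, w} \<in> three_cycles Q" and l: "L u < L v" "L v < L w" for u v w
  proof -
    \<comment> \<open>As \<open>x\<close> has the least label, it can only be the first vertex of an
      ordered 3-cycle.\<close>
    have kx: "L x \<le> L t" if "t \<in> V" for t
      using that x LS(1)[of t] LT(1)[of t] k' unfolding V_def by auto
    have vw: "v \<in> S \<union> T" "w \<in> S \<union> T" using kx[OF uV(1)] kx[OF uV(2)] uV(2,3) l unfolding V_def by auto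
    note te = three_cycle_edges[OF t wf]
    consider "u = x" | "u \<in> T" | "u \<in> S" using uV(1) unfolding V_def by auto
    then show ?thesis
    proof cases
      case 1
      \<comment> \<open>The neighbours of \<open>x\<close> have the consecutive labels
        \<open>k'\<close> (in \<open>Z\<close>) and \<open>Suc k'\<close> (for \<open>y\<close>),
        which leaves one possible ordered 3-cycle.\<close>
      have "v \<in> Z \<or> v = y" "w \<in> Z \<or> w = y"
        using vw te(1,2) xS xT unfolding 1 by (auto split: if_splits simp: of_bool_def)
      moreover have "L t = k'" if "t \<in> Z" for t using d2(4)[OF that] k' by simp
      ultimately have "v \<in> Z" "w = y" using l y by auto
      then show ?thesis using \<open>\<And>t. t \<in> Z \<Longrightarrow> L t = k'\<close> y 1 sx by simp
    next
      case 2
      \<comment> \<open>If \<open>v\<close> lay in \<open>S\<close>, so would \<open>w\<close>, and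
        both would be \<open>y\<close>, the only vertex of \<open>S\<close> joined to
        \<open>T\<close>. If only \<open>w\<close> lay in \<open>S\<close>, then \<open>u\<close>
        and \<open>v\<close> would both be in \<open>Z\<close> and carry the same label.\<close>
      have "v \<in> T"
      proof (rule ccontr)
        assume "v \<notin> T"
        then have v: "v \<in> S" using vw by simp
        then have w: "w \<in> S" using vw(2) LS(1)[OF v] LT(2)[of w] l by auto
        have "v = y" "w = y" using ST[OF v 2] ST[OF w 2] te(1,2)
          unfolding edges_commute[of Q u v] edges_commute[of Q u w] by (auto split: if_splits simp: of_bool_def)
        then show False using l by simp
      qed
      moreover have "w \<in> T"
      proof (rule ccontr)
        assume "w \<notin> T"
        then have w: "w \<in> S" using vw by simp
        have "u \<in> Z" "v \<in> Z" using ST[OF w 2] ST[OF w \<open>v \<in> T\<close>] te(2,3)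
          unfolding edges_commute[of Q u w] edges_commute[of Q v w] by (auto split: if_splits simp: of_bool_def)
        then show False using l d2(4) by simp
      qed
      ultimately show ?thesis using d2(11)[OF 2 _ _ t l] sT[OF 2] by simp
    next
      case 3
      have "v \<in> S" "w \<in> S" using vw l LS(1)[OF 3] LT(2)[of v] LT(2)[of w] by auto
      then show ?thesis using d1(11)[OF 3 _ _ t l] sS[OF 3] by simp
    qed
  qed
  have nonprim: "s u = Suc (L u)"
    if u: "u \<in> V" and np: "\<And>v w. v \<in> V \<Longrightarrow> w \<in> V \<Longrightarrow> {u, v, w} \<in> three_cycles Q \<Longrightarrow> L u < L v \<Longrightarrow> \<not> L v < L w" for u
  proof -
    consider "u = x" | "u \<in> S" | "u \<in> T" using u unfolding V_def by auto
    then show ?thesis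
    proof cases
      case 1
      \<comment> \<open>A vertex \<open>z\<close> in \<open>Z\<close> would give the ordered 3-cycle
        \<open>x\<close>, \<open>z\<close>, \<open>y\<close>, making \<open>x\<close>
        primary.\<close>
      have "Z = {}"
      proof (rule ccontr)
        assume "Z \<noteq> {}"
        then obtain z where z: "z \<in> Z" by blast
        then have zT: "z \<in> T" using d2(3) by auto
        have "{x, z, y} \<in> three_cycles Q" using tri[OF z] by (simp add: insert_commute)
        moreover have "L x < L z" using LT(1)[OF zT] x by simp
        moreover have "L z < L y" using LT(2)[OF zT] y by simp
        ultimately show False using np[of z y] 1 zT y unfolding V_def by simp
      qed
      then show ?thesis using Z k' sx x 1 by simp
    next
      case 2 then show ?thesis using d1(12)[OF 2] np sS unfolding V_def by simp
    next
      case 3 then show ?thesis using d2(12)[OF 3] np sT unfolding V_def by simp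
    qed
  qed
  have bij: "bij_betw L V {k - 1<..k - 1 + card V}"
  proof -
    have "bij_betw L (S \<union> T) ({k'<..k' + card S} \<union> {k<..k'})"
      by (rule bij_betw_combine) (use d1(2) d2(2) k' in auto)
    then have "bij_betw L ({x} \<union> (S \<union> T)) ({k} \<union> ({k'<..k' + card S} \<union> {k<..k'}))"
      by (rule bij_betw_combine[rotated]) (use x k' in \<open>auto simp: bij_betw_def\<close>)
    moreover have "{k} \<union> ({k'<..k' + card S} \<union> {k<..k'}) = {k - 1<..k - 1 + card V}"
      unfolding cardV using x k' by auto
    ultimately show ?thesis unfolding V_def by simp
  qed
  have last: "s v \<le> Suc (k' + card S) \<and> (s v = Suc (k' + card S) \<longleftrightarrow> v = f)" if v: "v \<in> V" for v
  proof -
    have f: "f \<in> S" using d1(3) by simp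
    have "card S > 0" using y d1(1) by (auto simp: card_gt_0_iff)
    consider "v = x" | "v \<in> S" | "v \<in> T" using v unfolding V_def by auto
    then show ?thesis
    proof cases
      case 1 then show ?thesis using sx f x \<open>card S > 0\<close> by auto
    next
      case 2 then show ?thesis using d1(6,7)[OF 2] sS[OF 2] by simp
    next
      case 3 then show ?thesis using sTle(1)[OF 3] f x \<open>card S > 0\<close> by auto
    qed
  qed
  have "good_labelling Q V L (k - 1) {f} s"
    unfolding good_labelling_def
  proof (intro conjI ballI impI)
    show "finite V" unfolding V_def using d1(1) d2(1) by simp
    show "{f} \<subseteq> V" using d1(3) unfolding V_def by auto
    show "L z = k - 1 + card V" if "z \<in> {f}" for z using d1(4)[OF that] cardV by simp
    show "s u = Suc (L u)" if "u \<in> V"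
      "\<forall>v\<in>V. \<forall>w\<in>V. {u, v, w} \<in> three_cycles Q \<longrightarrow> L u < L v \<longrightarrow> \<not> L v < L w" for u
      using nonprim that by blast
  qed (use bij sgt last cardV edge cyc in auto)
  then show ?thesis unfolding V_def by blast
qed

text \<open>The procedure adds a constant to the labels of each recursive call and of the second
  type A piece. Adding it to \<open>s\<close> as well preserves every comparison.\<close>

lemma good_labelling_shift:
  assumes "good_labelling Q V L' 0 Z s" "\<And>v. v \<in> V \<Longrightarrow> L v = k + L' v"
  shows "good_labelling Q V L k Z (\<lambda>v. k + s v)"
proof -
  note d = good_labellingD[OF assms(1)]
  have "bij_betw L V {k<..k + card V}"
  proof -
    have "bij_betw ((+) k) {0<..0 + card V} {k<..k + card V}"
      by (rule bij_betw_byWitness[of _ "\<lambda>i. i - k"]) auto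
    from bij_betw_trans[OF d(2) this] show ?thesis
      by (rule bij_betw_cong[THEN iffD1, rotated]) (use assms(2) in simp)
  qed
  moreover have "L w = Suc (L v) \<and> k + s u = L w"
    if "u \<in> V" "v \<in> V" "w \<in> V" "{u, v, w} \<in> three_cycles Q" "L u < L v" "L v < L w" for u v w
    using d(11)[OF that(1-4)] that assms(2) by simp
  moreover have "k + s u = Suc (L u)"
    if "u \<in> V" "\<forall>v\<in>V. \<forall>w\<in>V. {u, v, w} \<in> three_cycles Q \<longrightarrow> L u < L v \<longrightarrow> \<not> L v < L w" for u
    using d(12)[OF that(1)] that assms(2) by simp
  moreover have "L v < k + s v \<and> k + s v \<le> Suc (k + card V) \<and>
      (k + s v = Suc (k + card V) \<longleftrightarrow> v \<in> Z)" if "v \<in> V" for v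
    using d(5-7)[OF that] assms(2)[OF that] by simp
  moreover have "edges Q v w = of_bool (k + s v = L w \<or> k + s w = L v \<or> k + s v = k + s w)"
    if "v \<in> V" "w \<in> V" "v \<noteq> w" for v w
    using d(10)[OF that] assms(2)[OF that(1)] assms(2)[OF that(2)] by simp
  moreover have "L z = k + card V" if "z \<in> Z" for z
    using d(3,4) that assms(2)[of z] by auto
  ultimately show ?thesis unfolding good_labelling_def using d(1,3) by simp
qed

lemma three_cycles_full_subquiver:
  assumes "{u, v, w} \<subseteq> W"
  shows "{u, v, w} \<in> three_cycles (full_subquiver Q W) \<longleftrightarrow> {u, v, w} \<in> three_cycles Q"
proof
  assume "{u, v, w} \<in> three_cycles Q"
  then obtain a b c where abc: "{u, v, w} = {a, b, c}" "arr Q a b > 0" "arr Q b c > 0" "arr Q c a > 0"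
    unfolding three_cycles_def by blast
  have "a \<in> W" "b \<in> W" "c \<in> W" using assms unfolding abc(1) by simp_all
  then show "{u, v, w} \<in> three_cycles (full_subquiver Q W)"
    unfolding three_cycles_def full_subquiver_def using abc
    by (intro CollectI exI[of _ a] exI[of _ b] exI[of _ c]) simp
next
  assume "{u, v, w} \<in> three_cycles (full_subquiver Q W)"
  then obtain a b c where abc: "{u, v, w} = {a, b, c}" "arr (full_subquiver Q W) a b > 0"
      "arr (full_subquiver Q W) b c > 0" "arr (full_subquiver Q W) c a > 0"
    unfolding three_cycles_def by blast
  then show "{u, v, w} \<in> three_cycles Q"
    unfolding three_cycles_def full_subquiver_def
    by (intro CollectI exI[of _ a] exI[of _ b] exI[of _ c]) (simp split: if_splits)
qed

lemma good_labelling_full_subquiver: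
  assumes "good_labelling (full_subquiver Q W) V L k Z s" "V \<subseteq> W"
  shows "good_labelling Q V L k Z s"
proof -
  have t: "{u, v, w} \<in> three_cycles (full_subquiver Q W) \<longleftrightarrow> {u, v, w} \<in> three_cycles Q"
    if "u \<in> V" "v \<in> V" "w \<in> V" for u v w
    by (rule three_cycles_full_subquiver) (use that assms(2) in auto)
  have e: "edges (full_subquiver Q W) v w = edges Q v w" if "v \<in> V" "w \<in> V" for v w
    unfolding edges_def full_subquiver_def using that assms(2) by auto
  note d = good_labellingD[OF assms(1)]
  show ?thesis
    unfolding good_labelling_def
  proof (intro conjI ballI impI)
    show "edges Q v w = of_bool (s v = L w \<or> s w = L v \<or> s v = s w)"
      if "v \<in> V" "w \<in> V" "v \<noteq> w" for v w
      using d(10)[OF that] e[OF that(1,2)] by metis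
    show "L w = Suc (L v)" "s u = L w"
      if "u \<in> V" "v \<in> V" "w \<in> V" "{u, v, w} \<in> three_cycles Q" "L u < L v" "L v < L w" for u v w
      using d(11)[OF that(1-3) t[OF that(1-3), THEN iffD2, OF that(4)] that(5,6)] by simp_all
    show "s u = Suc (L u)"
      if "u \<in> V" "\<forall>v\<in>V. \<forall>w\<in>V. {u, v, w} \<in> three_cycles Q \<longrightarrow> L u < L v \<longrightarrow> \<not> L v < L w" for u
    proof (rule d(12)[OF that(1)])
      fix v w
      assume "v \<in> V" "w \<in> V" "{u, v, w} \<in> three_cycles (full_subquiver Q W)" "L u < L v"
      then show "\<not> L v < L w" using that t[OF that(1)] by simp
    qed
  qed ((rule d; assumption) | rule d(1-3))+
qed

section \<open>Base cases and the walk along a descending path\<close>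

lemma good_labelling_empty: "good_labelling Q {} L k {} s"
  by (simp add: good_labelling_def bij_betw_def)

lemma good_labelling_singleton: "L x = Suc k \<Longrightarrow> good_labelling Q {x} L k {x} (\<lambda>_. Suc (Suc k))"
  by (auto simp: good_labelling_def bij_betw_def)

text \<open>The step condition of \<open>A_labelling\<close> with the recursive labelling replaced
  by its outcome, a good labelling. Tree-likeness of the rooted subquiver is a premise here, because
  it is available only once the walk is known to descend in a tree.\<close>

definition steps_ok :: "'v quiver \<Rightarrow> ('v \<Rightarrow> nat) \<Rightarrow> 'v list \<Rightarrow> bool" where
  "steps_ok Q L p \<longleftrightarrow> (\<forall>i. i + 1 < length p \<longrightarrow>
     ((\<nexists>z y. primary_rel Q p (p ! i) z y) \<longrightarrow> L (p ! (i + 1)) = L (p ! i) + 1) \<and>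
     (\<forall>z y Q'. primary_rel Q p (p ! i) z y \<longrightarrow> Q' = rooted_subquiver Q z (p ! i) y \<longrightarrow>
        tree_like Q' \<longrightarrow>
        L (p ! (i + 1)) = L (p ! i) + card (verts Q') + 1 \<and>
        (\<exists>s. good_labelling Q (verts Q') L (L (p ! i)) {z} s)))"

text \<open>A later vertex \<open>y\<close> on the path that is joined to \<open>x\<close> must be
  the root of \<open>s\<close>. The third vertex is joined to both and cannot lie in
  \<open>s\<close>, where only the root is joined to \<open>x\<close>; so it is the root of the
  sibling \<open>t\<close>.\<close>

lemma fork_primary_rel:
  assumes wf: "wf_quiver Q" and fk: "fork Q x s t" and q: "tree_path s q" and p: "p = pre @ x # q"
    and pre: "set pre \<inter> insert x (set_tree s \<union> set_tree t) = {}"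
  shows "primary_rel Q p x z y \<longleftrightarrow> y = hd q \<and> z \<in> root_set t"
proof
  note qs = tree_path_set[OF q]
  have hdq: "hd q \<in> root_set s" "hd q \<in> set_tree s" using qs root_set_subset[of s] by auto
  {
    assume "primary_rel Q p x z y"
    then obtain i j where t: "{x, y, z} \<in> three_cycles Q" and ij: "i < j" "j < length p" "p ! i = x" "p ! j = y"
      unfolding primary_rel_def by blast
    \<comment> \<open>Since \<open>x\<close> does not occur in \<open>pre\<close>, whatever follows
      an occurrence of \<open>x\<close> lies on \<open>q\<close>.\<close>
    have "i \<ge> length pre"
    proof (rule ccontr)
      assume "\<not> ?thesis"
      then have "p ! i \<in> set pre" unfolding p by (simp add: nth_append)
      then show False using ij(3) pre by auto
    qed
    then have "y = q ! (j - Suc (length pre))" "j - Suc (length pre) < length q"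
      using ij unfolding p by (auto simp: nth_append nth_Cons')
    then have "y \<in> set q" by simp
    then have y: "y \<in> set_tree s" using qs by auto
    note te = three_cycle_edges[OF t wf]
    note td = three_cycle_distinct[OF wf t]
    have yr: "y \<in> root_set s" using forkD(7)[OF fk y] te(1) by (simp split: if_splits add: of_bool_def)
    then have yhd: "y = hd q" using hdq root_setD by metis
    have "z \<in> set_tree s \<or> z \<in> insert x (root_set t)"
      using hangsD(4)[OF forkD(1)[OF fk] y te(3)] by blast
    moreover have "z \<notin> set_tree s"
    proof
      assume z: "z \<in> set_tree s"
      then have "z \<in> root_set s" using forkD(7)[OF fk z] te(2) by (simp split: if_splits add: of_bool_def)
      then show False using yr td(3) root_setD by metis
    qed
    ultimately show "y = hd q \<and> z \<in> root_set t" using yhd td(2) by auto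
  }
  assume yz: "y = hd q \<and> z \<in> root_set t"
  have z: "z \<in> set_tree t" using yz root_set_subset[of t] by auto
  have "z \<notin> set p" using z pre qs forkD(5,6)[OF fk] unfolding p by auto
  moreover have "{x, y, z} \<in> three_cycles Q" using forkD(10)[OF fk hdq(1)] yz by simp
  moreover have "x \<noteq> y" using hdq(2) forkD(4)[OF fk] yz by auto
  moreover have "length pre < Suc (length pre)" "Suc (length pre) < length p"
      "p ! length pre = x" "p ! Suc (length pre) = y"
    using qs yz unfolding p by (auto simp: nth_append hd_conv_nth)
  ultimately show "primary_rel Q p x z y" unfolding primary_rel_def by blast
qed

text \<open>One step of the walk: the sibling tree \<open>t\<close> is labelled between
  \<open>x\<close> and the rest of the spine, and the three parts are joined. Working with
  \<open>fork\<close> treats left and right descent at once; \<open>pre\<close> records the part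
  already walked, since being primary refers to the whole string \<open>p\<close>.\<close>

lemma spine_step:
  assumes wf: "wf_quiver Q" and fk: "fork Q x s t" and q: "tree_path s q" and p: "p = pre @ x # q"
    and pre: "set pre \<inter> insert x (set_tree s \<union> set_tree t) = {}"
    and steps: "steps_ok Q L p" and Lx: "L x = Suc k"
    and IH: "\<And>k. L (hd q) = Suc k \<Longrightarrow> \<exists>s'. good_labelling Q (set_tree s) L k {last q} s'"
  shows "\<exists>s'. good_labelling Q (insert x (set_tree s \<union> set_tree t)) L k {last q} s'"
proof -
  note qs = tree_path_set[OF q]
  have y: "hd q \<in> root_set s" "hd q \<in> set_tree s" using qs root_set_subset[of s] by auto
  have rs: "w \<in> root_set s \<longleftrightarrow> w = hd q" for w using y(1) root_setD by metis
  note prim = fork_primary_rel[OF wf fk q p pre]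
  have i: "length pre + 1 < length p" "p ! length pre = x" "p ! (length pre + 1) = hd q"
    using qs unfolding p by (auto simp: nth_append hd_conv_nth)
  note st = steps[unfolded steps_ok_def, rule_format, OF i(1), unfolded i(2,3)]
  \<comment> \<open>If \<open>t\<close> is empty, then \<open>x\<close> is not primary and the label
    grows by 1; otherwise \<open>t\<close> is the rooted subquiver at the complementary
    vertex.\<close>
  have "\<exists>s'. L (hd q) = Suc (L x + card (set_tree t)) \<and> good_labelling Q (set_tree t) L (L x) (root_set t) s'"
  proof (cases t)
    case Leaf
    then show ?thesis using conjunct1[OF st] prim good_labelling_empty[of Q L "L x" L] by (intro exI[of _ L]) simp
  next
    case (Node l z r)
    have pr: "primary_rel Q p x z (hd q)" using prim Node by simp
    have z: "z \<in> root_set t" using Node by simp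
    have rq: "rooted_subquiver Q z x (hd q) = full_subquiver Q (set_tree t)"
      by (rule fork_rooted_subquiver[OF wf fk y(1) z])
    have h: "hangs Q (Node l z r) (insert x (root_set s))" using forkD(2)[OF fk] unfolding Node .
    have "tree_like (rooted_subquiver Q z x (hd q))"
      using hangs_full_subquiver[OF h] unfolding rq tree_like_def Node by (intro exI)
    moreover have "verts (rooted_subquiver Q z x (hd q)) = set_tree t"
      using hangsD(2)[OF h] unfolding rq Node full_subquiver_def by auto
    ultimately show ?thesis using conjunct2[OF st, rule_format, OF pr refl] Node by simp
  qed
  then obtain s2 where s2: "L (hd q) = Suc (L x + card (set_tree t))" "good_labelling Q (set_tree t) L (L x) (root_set t) s2"
    by blast
  obtain s1 where s1: "good_labelling Q (set_tree s) L (L x + card (set_tree t)) {last q} s1"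
    using IH[OF s2(1)] by blast
  have "\<exists>s'. good_labelling Q (insert x (set_tree s \<union> set_tree t)) L (L x - 1) {last q} s'"
  proof (rule good_labelling_join[OF wf s1 s2(2)])
    show "edges Q x w = of_bool (w = hd q)" if "w \<in> set_tree s" for w
      using forkD(7)[OF fk that] rs by simp
    show "edges Q x w = of_bool (w \<in> root_set t)" if "w \<in> set_tree t" for w
      using forkD(8)[OF fk that] .
    show "edges Q v w = of_bool (v = hd q \<and> w \<in> root_set t)" if "v \<in> set_tree s" "w \<in> set_tree t" for v w
      using forkD(9)[OF fk that] rs by simp
    show "{x, hd q, z} \<in> three_cycles Q" if "z \<in> root_set t" for z
      using forkD(10)[OF fk y(1) that] .
    show "root_set t = {} \<Longrightarrow> set_tree t = {}" by (cases t) simp_all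
  qed (use forkD(4-6)[OF fk] s2(1) y Lx in simp_all)
  then show ?thesis using Lx by simp
qed

text \<open>Where the path stops, both subtrees must be empty: its last vertex has a neighbour
  \<open>w\<close> outside its subtree, a child would be joined to \<open>w\<close> by the end
  vertex condition, and only the root of the subtree has outside neighbours. The premise for
  \<open>length q = 1\<close> provides \<open>w\<close>.\<close>

lemma spine_good_labelling:
  assumes wf: "wf_quiver Q" and steps: "steps_ok Q L p"
    and "tree_path t q" "hangs Q t P" "p = pre @ q" "set pre \<inter> set_tree t = {}" "L (hd q) = Suc k"
    and "length q = 1 \<Longrightarrow> \<exists>w\<in>P. edges Q (hd q) w > 0"
    and "\<And>u v. edges Q (last q) u > 0 \<Longrightarrow> edges Q (last q) v > 0 \<Longrightarrow> u \<noteq> v \<Longrightarrow> edges Q u v > 0"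
  shows "\<exists>s. good_labelling Q (set_tree t) L k {last q} s"
  using assms(3-)
proof (induction arbitrary: P pre k rule: tree_path.induct)
  case (root l x r)
  obtain w where w: "w \<in> P" "edges Q x w > 0" using root.prems(5) by auto
  note fk = hangs_fork[OF root.prems(1)]
  have no: "c \<notin> root_set l \<union> root_set r" for c
  proof
    assume c: "c \<in> root_set l \<union> root_set r"
    then have cs: "c \<in> set_tree l \<union> set_tree r" using root_set_subset[of l] root_set_subset[of r] by auto
    have "edges Q x c > 0"
      using c
    proof
      assume "c \<in> root_set l"
      then show ?thesis using forkD(7)[OF fk, of c] root_set_subset[of l] by auto
    next
      assume "c \<in> root_set r"
      then show ?thesis using forkD(8)[OF fk, of c] root_set_subset[of r] by auto
    qed
    moreover have "c \<noteq> w" using w(1) cs hangsD(3)[OF root.prems(1)] by auto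
    ultimately have "edges Q c w > 0" using root.prems(6)[of c w] w(2) by simp
    then have "w \<in> set_tree (Node l x r) \<or> c \<in> root_set (Node l x r)"
      using hangsD(4)[OF root.prems(1), of c w] cs by auto
    then show False using w(1) hangsD(3)[OF root.prems(1)] cs forkD(4,5)[OF fk] by auto
  qed
  have "l = Leaf" "r = Leaf" using no by (cases l; force) (use no in \<open>cases r; force\<close>)
  then show ?case using good_labelling_singleton[of L x k Q] root.prems(4) by auto
next
  case (left l q x r)
  note fk = hangs_fork[OF left.prems(1)]
  note qs = tree_path_set[OF left.hyps]
  have "\<exists>s. good_labelling Q (insert x (set_tree l \<union> set_tree r)) L k {last q} s"
  proof (rule spine_step[OF wf fk left.hyps left.prems(2) _ steps])
    show "\<exists>s'. good_labelling Q (set_tree l) L k {last q} s'" if "L (hd q) = Suc k" for k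
    proof (rule left.IH[OF forkD(1)[OF fk], of "pre @ [x]"])
      \<comment> \<open>The parent \<open>x\<close> is the required neighbour outside the
        child.\<close>
      show "\<exists>w\<in>insert x (root_set r). edges Q (hd q) w > 0"
        using forkD(7)[OF fk, of "hd q"] qs root_set_subset[of l] by (auto simp: edges_commute)
      show "edges Q u v > 0" if "edges Q (last q) u > 0" "edges Q (last q) v > 0" "u \<noteq> v" for u v
        using left.prems(6) that qs by simp
    qed (use left.prems forkD(4)[OF fk] that in auto)
  qed (use left.prems in auto)
  then show ?case using qs by simp
next
  case (right r q l x)
  note fk = fork_commute[OF hangs_fork[OF right.prems(1)]]
  note qs = tree_path_set[OF right.hyps]
  have "\<exists>s. good_labelling Q (insert x (set_tree r \<union> set_tree l)) L k {last q} s"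
  proof (rule spine_step[OF wf fk right.hyps right.prems(2) _ steps])
    show "\<exists>s'. good_labelling Q (set_tree r) L k {last q} s'" if "L (hd q) = Suc k" for k
    proof (rule right.IH[OF forkD(1)[OF fk], of "pre @ [x]"])
      show "\<exists>w\<in>insert x (root_set l). edges Q (hd q) w > 0"
        using forkD(7)[OF fk, of "hd q"] qs root_set_subset[of r] by (auto simp: edges_commute)
      show "edges Q u v > 0" if "edges Q (last q) u > 0" "edges Q (last q) v > 0" "u \<noteq> v" for u v
        using right.prems(6) that qs by simp
    qed (use right.prems forkD(4)[OF fk] that in auto)
  qed (use right.prems in auto)
  then show ?case using qs by (simp add: Un_commute)
qed

text \<open>With the tree rooted at \<open>e\<close>, the string from \<open>e\<close> to
  \<open>f\<close> is a descending path, and the induction hypothesis turns each recursive call into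
  a good labelling of the corresponding sibling tree.\<close>

lemma A_labelling_good_labelling:
  assumes "A_labelling Q e f L" "tree_like Q"
  shows "\<exists>s. good_labelling Q (verts Q) L 0 {f} s"
  using assms
proof (induction rule: A_labelling.induct)
  case (single Q e L)
  then show ?case using good_labelling_singleton[of L e 0 Q] by auto
next
  case (string Q e f p L)
  obtain l r where fo: "focus Q e l r Leaf Leaf"
    using end_vertex_focus[OF string.prems string.hyps(2)] .
  note h = focus_hangs[OF fo] and wf = focus_wf[OF fo]
  have p: "is_string Q p" "hd p = e" "last p = f"
    using string.hyps(5) unfolding string_from_to_def by simp_all
  have tp: "tree_path (Node l e r) p"
    by (rule string_is_tree_path[OF wf h(1) p(1)]) (simp_all add: p(2))
  have "steps_ok Q L p"
    unfolding steps_ok_def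
  proof (intro allI impI conjI)
    fix i assume i: "i + 1 < length p"
    note st = string.IH[rule_format, OF i]
    show "L (p ! (i + 1)) = L (p ! i) + 1" if "\<nexists>z y. primary_rel Q p (p ! i) z y"
      using st that by blast
    fix z y Q'
    assume pr: "primary_rel Q p (p ! i) z y" and Q': "Q' = rooted_subquiver Q z (p ! i) y"
      and tl: "tree_like Q'"
    note st' = conjunct2[OF st, rule_format, OF conjI[OF pr conjI[OF Q' refl]]]
    show "L (p ! (i + 1)) = L (p ! i) + card (verts Q') + 1" using st' by blast
    obtain L' s where s: "good_labelling Q' (verts Q') L' 0 {z} s" "\<forall>v\<in>verts Q'. L v = L (p ! i) + L' v"
      using st' tl by blast
    have "good_labelling Q' (verts Q') L (L (p ! i)) {z} (\<lambda>v. L (p ! i) + s v)"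
      by (rule good_labelling_shift[OF s(1)]) (use s(2) in blast)
    then have "good_labelling Q (verts Q') L (L (p ! i)) {z} (\<lambda>v. L (p ! i) + s v)"
      unfolding Q' rooted_subquiver_def
      by (rule good_labelling_full_subquiver) (simp add: full_subquiver_def)
    then show "\<exists>s. good_labelling Q (verts Q') L (L (p ! i)) {z} s"
      by (rule exI[of _ "\<lambda>v. L (p ! i) + s v"])
  qed
  then have "\<exists>s. good_labelling Q (set_tree (Node l e r)) L 0 {last p} s"
  proof (rule spine_good_labelling[OF wf _ tp h(1), of L p "[]"])
    \<comment> \<open>This case is void: \<open>e \<noteq> f\<close>, so the path has more than one
      vertex.\<close>
    show "\<exists>w\<in>{}. edges Q (hd p) w > 0" if "length p = 1"
      using that p(2,3) string.hyps(4) by (cases p) auto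
    show "edges Q u v > 0" if "edges Q (last p) u > 0" "edges Q (last p) v > 0" "u \<noteq> v" for u v
      using end_vertex_neighbours[OF wf string.hyps(3)] that p(3) by simp
  qed (use p(2) string.hyps(6) in simp_all)
  then show ?case unfolding h(2) p(3) .
qed

lemma A_labelling_first: "A_labelling Q e f L \<Longrightarrow> L e = 1"
  by (erule A_labelling.cases) auto

section \<open>Coordinates in the root system of type D\<close>

text \<open>All roots have square length 2, so Cartan numbers are inner products. The Dynkin diagram
  determines only their squares; the sign needs the simple system.\<close>

lemma root_system_D_simps:
  fixes \<Phi> :: "'a::euclidean_space set"
  assumes "root_system_D n \<Phi> \<alpha>"
  shows "r \<in> \<Phi> \<Longrightarrow> r \<bullet> r = 2"
    and "i \<in> {1..n} \<Longrightarrow> \<alpha> i \<in> \<Phi>"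
    and "i \<in> {1..n} \<Longrightarrow> j \<in> {1..n} \<Longrightarrow> i \<noteq> j \<Longrightarrow> (\<alpha> i \<bullet> \<alpha> j)\<^sup>2 = of_bool (D_joined n i j)"
    and "r \<in> \<Phi> \<Longrightarrow> s \<in> \<Phi> \<Longrightarrow> r - (r \<bullet> s) *\<^sub>R s \<in> \<Phi>"
    and "inj_on \<alpha> {1..n}" "independent (\<alpha> ` {1..n})" "span (\<alpha> ` {1..n}) = UNIV"
    and "r \<in> \<Phi> \<Longrightarrow> \<exists>c::'a \<Rightarrow> int. r = (\<Sum>s\<in>\<alpha> ` {1..n}. of_int (c s) *\<^sub>R s) \<and>
      ((\<forall>s\<in>\<alpha> ` {1..n}. c s \<ge> 0) \<or> (\<forall>s\<in>\<alpha> ` {1..n}. c s \<le> 0))"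
proof -
  note a = assms[unfolded root_system_D_def]
  have rs: "root_system \<Phi>" and two: "\<forall>r\<in>\<Phi>. r \<bullet> r = 2" and inj: "inj_on \<alpha> {1..n}"
    and ss: "simple_system \<Phi> (\<alpha> ` {1..n})"
    and J: "\<forall>i\<in>{1..n}. \<forall>j\<in>{1..n}. i \<noteq> j \<longrightarrow>
        cartan_number (\<alpha> i) (\<alpha> j) * cartan_number (\<alpha> j) (\<alpha> i) = (if D_joined n i j then 1 else 0)"
    using a by blast+
  show two': "r \<in> \<Phi> \<Longrightarrow> r \<bullet> r = 2" for r using two by blast
  have sub: "\<alpha> ` {1..n} \<subseteq> \<Phi>" and ind: "independent (\<alpha> ` {1..n})"
    and sp: "span (\<alpha> ` {1..n}) = span \<Phi>"
    using ss unfolding simple_system_def by blast+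
  show mem: "i \<in> {1..n} \<Longrightarrow> \<alpha> i \<in> \<Phi>" for i using sub by blast
  show "(\<alpha> i \<bullet> \<alpha> j)\<^sup>2 = of_bool (D_joined n i j)" if "i \<in> {1..n}" "j \<in> {1..n}" "i \<noteq> j"
    using J[rule_format, OF that] two'[OF mem[OF that(1)]] two'[OF mem[OF that(2)]]
    by (simp add: cartan_number_def power2_eq_square inner_commute split: if_splits)
  show "r - (r \<bullet> s) *\<^sub>R s \<in> \<Phi>" if "r \<in> \<Phi>" "s \<in> \<Phi>"
  proof -
    have "reflection s ` \<Phi> = \<Phi>" using rs that unfolding root_system_def by blast
    then have "reflection s r \<in> \<Phi>" using that by blast
    then show ?thesis using two'[OF that(2)] by (simp add: reflection_def)
  qed
  show "inj_on \<alpha> {1..n}" "independent (\<alpha> ` {1..n})" by (fact inj ind)+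
  show "span (\<alpha> ` {1..n}) = UNIV" using sp rs unfolding root_system_def by simp
  show "r \<in> \<Phi> \<Longrightarrow> \<exists>c::'a \<Rightarrow> int. r = (\<Sum>s\<in>\<alpha> ` {1..n}. of_int (c s) *\<^sub>R s) \<and>
      ((\<forall>s\<in>\<alpha> ` {1..n}. c s \<ge> 0) \<or> (\<forall>s\<in>\<alpha> ` {1..n}. c s \<le> 0))"
    using ss unfolding simple_system_def by blast
qed

lemma root_add:
  assumes "root_system_D n \<Phi> \<alpha>" "r \<in> \<Phi>" "s \<in> \<Phi>" "r \<bullet> s = -1"
  shows "r + s \<in> \<Phi>"
  using root_system_D_simps(4)[OF assms(1-3)] assms(4) by simp

text \<open>Inner product 1 would make \<open>\<alpha> i - \<alpha> j\<close> a root by reflection,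
  although its coefficients in the simple roots have both signs.\<close>

lemma simple_roots_inner:
  fixes \<Phi> :: "'a::euclidean_space set"
  assumes D: "root_system_D n \<Phi> \<alpha>" and ij: "i \<in> {1..n}" "j \<in> {1..n}" "i \<noteq> j"
  shows "\<alpha> i \<bullet> \<alpha> j = - of_bool (D_joined n i j)"
proof -
  note R = root_system_D_simps[OF D]
  have "\<alpha> i \<bullet> \<alpha> j \<noteq> 1"
  proof
    assume "\<alpha> i \<bullet> \<alpha> j = 1"
    then have "\<alpha> i - \<alpha> j \<in> \<Phi>" using R(4)[OF R(2)[OF ij(1)] R(2)[OF ij(2)]] by simp
    then obtain c :: "'a \<Rightarrow> int" where c: "\<alpha> i - \<alpha> j = (\<Sum>s\<in>\<alpha> ` {1..n}. of_int (c s) *\<^sub>R s)"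
      and sgn: "(\<forall>s\<in>\<alpha> ` {1..n}. c s \<ge> 0) \<or> (\<forall>s\<in>\<alpha> ` {1..n}. c s \<le> 0)"
      using R(8) by blast
    have ne: "\<alpha> i \<noteq> \<alpha> j" using inj_onD[OF R(5)] ij by blast
    define d where "d s = (of_bool (s = \<alpha> i) - of_bool (s = \<alpha> j) :: real)" for s
    have "(\<Sum>s\<in>\<alpha> ` {1..n}. d s *\<^sub>R s)
        = (\<Sum>s\<in>\<alpha> ` {1..n}. if s = \<alpha> i then s else 0) - (\<Sum>s\<in>\<alpha> ` {1..n}. if s = \<alpha> j then s else 0)"
      unfolding sum_subtractf[symmetric] d_def by (rule sum.cong) (auto simp: ne)
    also have "\<dots> = \<alpha> i - \<alpha> j" using ij by simp
    finally have "(\<Sum>s\<in>\<alpha> ` {1..n}. (of_int (c s) - d s) *\<^sub>R s) = 0"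
      using c by (simp add: scaleR_diff_left sum_subtractf)
    then have "\<forall>s\<in>\<alpha> ` {1..n}. of_int (c s) - d s = 0"
      using R(6) unfolding independent_explicit_finite_subsets
      by (elim allE[of _ "\<alpha> ` {1..n}"]) (auto dest: spec[of _ "\<lambda>s. of_int (c s) - d s"])
    then have "of_int (c (\<alpha> i)) = d (\<alpha> i)" "of_int (c (\<alpha> j)) = d (\<alpha> j)" using ij by auto
    then have "real_of_int (c (\<alpha> i)) = 1" "real_of_int (c (\<alpha> j)) = -1" using ne unfolding d_def by auto
    then have "c (\<alpha> i) = 1" "c (\<alpha> j) = -1" by linarith+
    then show False using sgn ij by force
  qed
  then show ?thesis
    using R(3)[OF ij] by (cases "D_joined n i j") (auto simp: power2_eq_1_iff)
qed

text \<open>The standard model is recovered by solving its equations for the coordinate vectors,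
  starting from the two last simple roots.\<close>

lemma root_system_D_coordinates:
  fixes \<Phi> :: "'a::euclidean_space set"
  assumes D: "root_system_D n \<Phi> \<alpha>" and n: "n \<ge> 4"
  shows "\<exists>\<epsilon>. (\<forall>i\<in>{1..n}. \<forall>j\<in>{1..n}. \<epsilon> i \<bullet> \<epsilon> j = of_bool (i = j)) \<and>
    (\<forall>i\<in>{1..<n}. \<alpha> i = \<epsilon> i - \<epsilon> (Suc i)) \<and> \<alpha> n = \<epsilon> (n - 1) + \<epsilon> n"
proof -
  note R = root_system_D_simps[OF D]
  \<comment> \<open>For \<open>i = n - 1\<close> the sum is empty, so
    \<open>\<epsilon> (n - 1)\<close> and \<open>\<epsilon> n\<close> are half the sum and half the
    difference of \<open>\<alpha> n\<close> and \<open>\<alpha> (n - 1)\<close>.\<close>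
  define \<epsilon> where "\<epsilon> i = (if i = n then (1/2) *\<^sub>R (\<alpha> n - \<alpha> (n - 1))
      else (1/2) *\<^sub>R (\<alpha> n + \<alpha> (n - 1)) + (\<Sum>k = i..n - 2. \<alpha> k))" for i
  have in_n: "\<epsilon> n = (1/2) *\<^sub>R (\<alpha> n - \<alpha> (n - 1))" by (simp add: \<epsilon>_def)
  have in_n1: "\<epsilon> (n - 1) = (1/2) *\<^sub>R (\<alpha> n + \<alpha> (n - 1))" using n by (auto simp: \<epsilon>_def)
  have rec: "\<epsilon> i = \<alpha> i + \<epsilon> (Suc i)" if "1 \<le> i" "i \<le> n - 2" for i
  proof -
    have "i \<noteq> n" "Suc i \<noteq> n" using that n by auto
    then show ?thesis using that by (simp add: \<epsilon>_def sum.atLeast_Suc_atMost)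
  qed
  have half: "(1/2) *\<^sub>R v + (1/2) *\<^sub>R v = v" for v :: 'a
    by (simp flip: scaleR_add_left)
  have last: "\<alpha> n = \<epsilon> (n - 1) + \<epsilon> n" "\<alpha> (n - 1) = \<epsilon> (n - 1) - \<epsilon> n"
    unfolding in_n in_n1 using half[of "\<alpha> n"] half[of "\<alpha> (n - 1)"]
    by (simp_all add: scaleR_add_right scaleR_diff_right algebra_simps)
  have sq: "\<alpha> i \<bullet> \<alpha> i = 2" if "1 \<le> i" "i \<le> n" for i using R(1,2) that by simp
  note ip = simple_roots_inner[OF D]
  have ann: "\<alpha> (n - 1) \<bullet> \<alpha> n = 0" "\<alpha> n \<bullet> \<alpha> (n - 1) = 0"
    using ip[of "n - 1" n] ip[of n "n - 1"] n by (auto simp: D_joined_def)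
  have an: "\<alpha> i \<bullet> \<alpha> n = - of_bool (i = n - 2)" "\<alpha> i \<bullet> \<alpha> (n - 1) = - of_bool (i = n - 2)"
    if "1 \<le> i" "i \<le> n - 2" for i
    using ip[of i n] ip[of i "n - 1"] that n by (auto simp: D_joined_def)
  have ij: "\<alpha> i \<bullet> \<alpha> j = - of_bool (j = Suc i)" if "1 \<le> i" "i < j" "j \<le> n - 2" for i j
    using ip[of i j] that n by (auto simp: D_joined_def)
  have ae_n: "\<alpha> i \<bullet> \<epsilon> n = 0" if "1 \<le> i" "i \<le> n - 2" for i
    using an[OF that] by (simp add: in_n inner_diff_right)
  have ae: "\<alpha> i \<bullet> \<epsilon> j = - of_bool (j = Suc i)"
    if "1 \<le> i" "i \<le> n - 2" "i < j" "j \<le> n - 1" for i j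
    using that(4,3)
  proof (induction j rule: inc_induct)
    case base
    have "\<alpha> i \<bullet> \<epsilon> (n - 1) = - of_bool (i = n - 2)"
      unfolding in_n1 using an[OF that(1,2)] by (simp add: inner_add_right)
    moreover have "i = n - 2 \<longleftrightarrow> n - 1 = Suc i" using n by auto
    ultimately show ?case by simp
  next
    case (step k)
    then show ?case using rec[of k] ij[OF that(1), of k] that(1) by (auto simp: inner_add_right)
  qed
  have nn: "\<epsilon> n \<bullet> \<epsilon> n = 1" "\<epsilon> (n - 1) \<bullet> \<epsilon> (n - 1) = 1" "\<epsilon> (n - 1) \<bullet> \<epsilon> n = 0"
    unfolding in_n in_n1 using sq[of n] sq[of "n - 1"] ann n
    by (simp_all add: inner_diff_left inner_diff_right inner_add_left inner_add_right)
  \<comment> \<open>Downward induction along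
    \<open>\<epsilon> i = \<alpha> i + \<epsilon> (Suc i)\<close>: the square length is 2 - 2 + 1 =
    1, and in the product with \<open>\<epsilon> (Suc i)\<close> the terms -1 and 1 cancel.\<close>
  have main: "\<epsilon> i \<bullet> \<epsilon> i = 1 \<and> (\<forall>j\<in>{i<..n}. \<epsilon> i \<bullet> \<epsilon> j = 0)" if "1 \<le> i" "i \<le> n - 1" for i
    using that(2,1)
  proof (induction i rule: inc_induct)
    case base
    have "{n - 1<..n} = {n}" using n by auto
    then show ?case using nn by simp
  next
    case (step i)
    have i: "1 \<le> i" "i \<le> n - 2" using step by auto
    have IH: "\<epsilon> (Suc i) \<bullet> \<epsilon> (Suc i) = 1" "\<forall>j\<in>{Suc i<..n}. \<epsilon> (Suc i) \<bullet> \<epsilon> j = 0" using step by auto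
    have as: "\<alpha> i \<bullet> \<epsilon> (Suc i) = -1" using ae[OF i, of "Suc i"] i n by simp
    have "\<epsilon> i \<bullet> \<epsilon> i = 1"
      unfolding rec[OF i] using as IH sq[of i] i
      by (simp add: inner_add_left inner_add_right inner_commute)
    moreover have "\<epsilon> i \<bullet> \<epsilon> j = 0" if "j \<in> {i<..n}" for j
    proof (cases "j = Suc i")
      case True then show ?thesis unfolding rec[OF i] using as IH by (simp add: inner_add_left)
    next
      case False
      then have "\<alpha> i \<bullet> \<epsilon> j = 0" using ae_n[OF i] ae[OF i, of j] that by (cases "j = n") auto
      then show ?thesis unfolding rec[OF i] using IH(2) that False by (simp add: inner_add_left)
    qed
    ultimately show ?case by blast
  qed
  have "\<epsilon> i \<bullet> \<epsilon> j = of_bool (i = j)" if ij: "i \<in> {1..n}" "j \<in> {1..n}" for i j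
  proof -
    consider "i = j" "i = n" | "i = j" "i \<le> n - 1" | "i < j" "i \<le> n - 1" | "j < i" "j \<le> n - 1"
      using ij by atomize_elim auto
    then show ?thesis
    proof cases
      case 1 then show ?thesis using nn by simp
    next
      case 2 then show ?thesis using main[of i] ij by simp
    next
      case 3 then show ?thesis using main[of i] ij by simp
    next
      case 4 then show ?thesis using main[of j] ij by (simp add: inner_commute)
    qed
  qed
  moreover have "\<alpha> i = \<epsilon> i - \<epsilon> (Suc i)" if "i \<in> {1..<n}" for i
  proof (cases "i = n - 1")
    case True then show ?thesis using last(2) n by simp
  next
    case False
    then have "i \<le> n - 2" using that by auto
    then show ?thesis using rec[of i] that by simp
  qed
  ultimately show ?thesis using last(1) by blast
qed

lemma coordinates_telescope:
  fixes \<alpha> \<epsilon> :: "nat \<Rightarrow> 'a::ab_group_add"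
  assumes "\<And>k. k \<in> {i..<j} \<Longrightarrow> \<alpha> k = \<epsilon> k - \<epsilon> (Suc k)" "i \<le> j"
  shows "(\<Sum>k = i..<j. \<alpha> k) = \<epsilon> i - \<epsilon> j"
proof -
  have "(\<Sum>k = i..<j. \<alpha> k) = (\<Sum>k = i..<j. \<epsilon> k - \<epsilon> (Suc k))"
    by (rule sum.cong) (use assms(1) in auto)
  also have "\<dots> = - (\<Sum>k = i..<j. \<epsilon> (Suc k) - \<epsilon> k)" by (simp flip: sum_negf)
  also have "\<dots> = \<epsilon> i - \<epsilon> j" using sum_Suc_diff'[OF assms(2), of \<epsilon>] by simp
  finally show ?thesis .
qed

text \<open>Each vector is reached from simple roots by repeatedly adding a root with inner product
  -1.\<close>

lemma coordinates_roots:
  assumes D: "root_system_D n \<Phi> \<alpha>" and n: "n \<ge> 4"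
    and on: "\<And>i j. i \<in> {1..n} \<Longrightarrow> j \<in> {1..n} \<Longrightarrow> \<epsilon> i \<bullet> \<epsilon> j = of_bool (i = j)"
    and \<alpha>: "\<And>i. i \<in> {1..<n} \<Longrightarrow> \<alpha> i = \<epsilon> i - \<epsilon> (Suc i)" "\<alpha> n = \<epsilon> (n - 1) + \<epsilon> n"
  shows "1 \<le> i \<Longrightarrow> i < j \<Longrightarrow> j \<le> n \<Longrightarrow> \<epsilon> i - \<epsilon> j \<in> \<Phi>"
    and "1 \<le> i \<Longrightarrow> i < n - 1 \<Longrightarrow> \<epsilon> i + \<epsilon> n \<in> \<Phi>"
proof -
  note R = root_system_D_simps[OF D]
  have diff: "j \<le> n \<longrightarrow> \<epsilon> i - \<epsilon> j \<in> \<Phi>" if "1 \<le> i" "Suc i \<le> j" for i j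
    using that(2)
  proof (induction j rule: dec_induct)
    case base
    then show ?case using \<alpha>(1)[of i] R(2)[of i] that(1) by auto
  next
    case (step j)
    show ?case
    proof
      assume j: "Suc j \<le> n"
      have "(\<epsilon> i - \<epsilon> j) + (\<epsilon> j - \<epsilon> (Suc j)) \<in> \<Phi>"
      proof (rule root_add[OF D])
        show "\<epsilon> i - \<epsilon> j \<in> \<Phi>" using step j by simp
        show "\<epsilon> j - \<epsilon> (Suc j) \<in> \<Phi>" using \<alpha>(1)[of j] R(2)[of j] j step(1) that(1) by simp
        show "(\<epsilon> i - \<epsilon> j) \<bullet> (\<epsilon> j - \<epsilon> (Suc j)) = -1"
          using step(1) that(1) j by (simp add: inner_diff_left inner_diff_right on)
      qed
      then show "\<epsilon> i - \<epsilon> (Suc j) \<in> \<Phi>" by simp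
    qed
  qed
  then show "1 \<le> i \<Longrightarrow> i < j \<Longrightarrow> j \<le> n \<Longrightarrow> \<epsilon> i - \<epsilon> j \<in> \<Phi>" by simp
  assume i: "1 \<le> i" "i < n - 1"
  have "(\<epsilon> i - \<epsilon> (n - 1)) + (\<epsilon> (n - 1) + \<epsilon> n) \<in> \<Phi>"
  proof (rule root_add[OF D])
    show "\<epsilon> i - \<epsilon> (n - 1) \<in> \<Phi>" using diff[of i "n - 1"] i by simp
    show "\<epsilon> (n - 1) + \<epsilon> n \<in> \<Phi>" using \<alpha>(2) R(2)[of n] n by simp
    show "(\<epsilon> i - \<epsilon> (n - 1)) \<bullet> (\<epsilon> (n - 1) + \<epsilon> n) = -1"
      using i n by (auto simp: inner_diff_left inner_add_right on)
  qed
  then show "\<epsilon> i + \<epsilon> n \<in> \<Phi>" by simp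
qed

section \<open>Integral spans and bases of the root lattice\<close>

lemma int_span_subset_span: "int_span S \<subseteq> span S"
proof (rule int_mod.span_minimal)
  show "S \<subseteq> span S" by (rule span_superset)
  show "int_mod.subspace (span S)"
    by (rule int_mod.subspaceI) (auto intro: span_zero span_add span_scale)
qed

lemma independent_imp_int_independent: "independent S \<Longrightarrow> \<not> int_dependent S"
proof
  assume ind: "independent S" and "int_dependent S"
  then obtain t u where t: "finite t" "t \<subseteq> S" "(\<Sum>v\<in>t. of_int (u v) *\<^sub>R v) = 0" "\<exists>v\<in>t. u v \<noteq> (0::int)"
    unfolding int_mod.dependent_explicit by blast
  then have "dependent S" unfolding dependent_explicit
    by (intro exI[of _ t] exI[of _ "\<lambda>v. of_int (u v)"]) auto
  then show False using ind by simp
qed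

text \<open>Generating the simple roots makes the family span the whole space, whose dimension is
  \<open>n\<close>. With only \<open>n\<close> members it must then be injective and linearly
  independent over the reals, hence over the integers.\<close>

lemma root_lattice_basis:
  fixes \<Phi> :: "'a::euclidean_space set"
  assumes D: "root_system_D n \<Phi> \<alpha>" and V: "finite V" "card V = n" "\<gamma> ` V \<subseteq> \<Phi>"
    and gen: "\<And>i. i \<in> {1..n} \<Longrightarrow> \<alpha> i \<in> int_span (\<gamma> ` V)"
  shows "inj_on \<gamma> V" "\<not> int_dependent (\<gamma> ` V)" "int_span (\<gamma> ` V) = int_span \<Phi>"
proof -
  note R = root_system_D_simps[OF D]
  have "r \<in> int_span (\<gamma> ` V)" if "r \<in> \<Phi>" for r
  proof -
    obtain c :: "'a \<Rightarrow> int" where "r = (\<Sum>s\<in>\<alpha> ` {1..n}. of_int (c s) *\<^sub>R s)"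
      using R(8)[OF \<open>r \<in> \<Phi>\<close>] by blast
    then show ?thesis using gen by (auto intro!: int_mod.span_sum int_mod.span_scale)
  qed
  then have "int_span \<Phi> \<subseteq> int_span (\<gamma> ` V)"
    by (intro int_mod.span_minimal int_mod.subspace_span) blast
  then show "int_span (\<gamma> ` V) = int_span \<Phi>" using int_mod.span_mono[OF V(3)] by blast
  have "\<alpha> ` {1..n} \<subseteq> span (\<gamma> ` V)" using gen int_span_subset_span[of "\<gamma> ` V"] by blast
  then have "span (\<alpha> ` {1..n}) \<subseteq> span (\<gamma> ` V)" by (rule span_minimal) (rule subspace_span)
  then have sp: "span (\<gamma> ` V) = UNIV" using R(7) by auto
  have "dim (UNIV :: 'a set) = card (\<alpha> ` {1..n})"
    using R(6,7) dim_eq_card_independent dim_span by metis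
  then have dim: "dim (UNIV :: 'a set) = n" using card_image[OF R(5)] by simp
  have "card (\<gamma> ` V) \<le> n" using card_image_le[OF V(1), of \<gamma>] V(2) by simp
  moreover have "n \<le> card (\<gamma> ` V)" using dim_le_card[of UNIV "\<gamma> ` V"] sp dim V(1) by simp
  ultimately have card: "card (\<gamma> ` V) = n" by simp
  then show "inj_on \<gamma> V" using V(1,2) by (simp add: eq_card_imp_inj_on)
  have "independent (\<gamma> ` V)"
    by (rule card_le_dim_spanning[of _ UNIV]) (use sp card dim V(1) in auto)
  then show "\<not> int_dependent (\<gamma> ` V)" by (rule independent_imp_int_independent)
qed

text \<open>For \<open>i \<noteq> k\<close> three coincidences of indices can contribute, and the
  orderings \<open>i < j\<close> and \<open>k < l\<close> allow at most one of them, so nothing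
  cancels.\<close>

lemma inner_coordinate_diffs:
  fixes \<epsilon> :: "nat \<Rightarrow> 'a::real_inner"
  assumes "\<And>i j. i \<in> {1..n} \<Longrightarrow> j \<in> {1..n} \<Longrightarrow> \<epsilon> i \<bullet> \<epsilon> j = of_bool (i = j)"
    and "1 \<le> i" "i < j" "j \<le> n" "1 \<le> k" "k < l" "l \<le> n" "i \<noteq> k"
  shows "\<bar>(\<epsilon> i - \<epsilon> j) \<bullet> (\<epsilon> k - \<epsilon> l)\<bar> = of_bool (j = k \<or> l = i \<or> j = l)"
proof -
  have "(\<epsilon> i - \<epsilon> j) \<bullet> (\<epsilon> k - \<epsilon> l) = of_bool (j = l) - of_bool (i = l) - of_bool (j = k)"
    using assms(2-) by (simp add: inner_diff_left inner_diff_right assms(1))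
  then show ?thesis using assms(2-) by auto
qed

text \<open>Passing from \<open>i\<close> to the given \<open>j\<close> raises the index until
  \<open>q\<close> is reached, and the differences telescope.\<close>

lemma descending_diffs:
  fixes \<epsilon> :: "nat \<Rightarrow> 'a::ab_group_add"
  assumes "\<And>i. p \<le> i \<Longrightarrow> i < q \<Longrightarrow> \<exists>j. i < j \<and> j \<le> q \<and> \<epsilon> i - \<epsilon> j \<in> M"
    and "0 \<in> M" "\<And>u v. u \<in> M \<Longrightarrow> v \<in> M \<Longrightarrow> u + v \<in> M"
  shows "p \<le> i \<Longrightarrow> i \<le> q \<Longrightarrow> \<epsilon> i - \<epsilon> q \<in> M"
proof (induction "q - i" arbitrary: i rule: less_induct)
  case less
  show ?case
  proof (cases "i = q")
    case True then show ?thesis using assms(2) by simp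
  next
    case False
    then obtain j where j: "i < j" "j \<le> q" "\<epsilon> i - \<epsilon> j \<in> M" using assms(1)[of i] less.prems by auto
    then have "\<epsilon> j - \<epsilon> q \<in> M" using less.hyps[of j] less.prems by simp
    from assms(3)[OF j(3) this] show ?thesis by simp
  qed
qed

section \<open>The companion basis\<close>

lemma tree_like_wf: "tree_like Q \<Longrightarrow> wf_quiver Q"
  unfolding tree_like_def by (elim exE) (rule focus_wf)

lemma three_cycle_verts:
  assumes "wf_quiver Q" "{x, y, z} \<in> three_cycles Q"
  shows "x \<in> verts Q" "y \<in> verts Q" "z \<in> verts Q"
proof -
  have v: "u \<in> verts Q \<and> v \<in> verts Q" if "edges Q u v > 0" for u v
    using that assms(1) unfolding wf_quiver_def edges_def by (metis add_gr_0)
  show "x \<in> verts Q" "y \<in> verts Q" "z \<in> verts Q"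
    using v[OF three_cycle_edges(1)[OF assms(2,1)]] v[OF three_cycle_edges(3)[OF assms(2,1)]] by simp_all
qed

theorem theorem4p4:
  fixes n m :: nat
    and G G1 G2 :: "'v quiver"
    and c1 a c2 b :: 'v
    and L :: "'v \<Rightarrow> nat"
    and \<Phi> :: "'a::euclidean_space set"
    and \<alpha> :: "nat \<Rightarrow> 'a"
  assumes "n \<ge> 4"
    and "type_III n m G1 G2 c1 a c2 b G"
    and "mutation_type_D n G"
    and "type_III_labelling n m G1 G2 c1 a c2 b L"
    and "root_system_D n \<Phi> \<alpha>"
  shows "companion_basis \<Phi> G (\<lambda>x. beta n m G1 G2 L \<alpha> (L x))"
proof -

  \<comment> \<open>The two type A pieces and their labels\<close>
  define V1 where "V1 = verts G1"
  define V2 where "V2 = verts G2"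
  define F where "F = four_cycle c1 a c2 b"
  have m: "1 \<le> m" "m + 3 \<le> n" and dist: "distinct [c1, a, c2, b]"
    and A1: "mutation_type_A m G1" and A2: "mutation_type_A (n - m - 2) G2"
    and meet: "verts F \<inter> V1 = {c1}" "verts F \<inter> V2 = {c2}" "V1 \<inter> V2 = {}"
    and G: "G = quiver_union F (quiver_union G1 G2)"
    using assms(2) unfolding type_III_def V1_def V2_def F_def by simp_all
  have tl: "tree_like G1" "tree_like G2" and card: "card V1 = m" "card V2 = n - m - 2"
    using mutation_type_A_tree_like[OF A1] mutation_type_A_tree_like[OF A2] m
    unfolding V1_def V2_def by auto
  note wf1 = tree_like_wf[OF tl(1)] and wf2 = tree_like_wf[OF tl(2)]
  have vF: "verts F = {c1, a, c2, b}" by (simp add: F_def four_cycle_def)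
  have mem: "c1 \<in> V1" "c2 \<in> V2" "c1 \<notin> V2" "c2 \<notin> V1" "a \<notin> V1" "a \<notin> V2" "b \<notin> V1" "b \<notin> V2"
  proof -
    have "x \<in> V1 \<longleftrightarrow> x = c1" "x \<in> V2 \<longleftrightarrow> x = c2" if "x \<in> {c1, a, c2, b}" for x
      using meet(1,2) that unfolding vF by blast+
    from this[of c1] this[of a] this[of c2] this[of b]
    show "c1 \<in> V1" "c2 \<in> V2" "c1 \<notin> V2" "c2 \<notin> V1" "a \<notin> V1" "a \<notin> V2" "b \<notin> V1" "b \<notin> V2"
      using dist by auto
  qed
  obtain u1 L1 where L1: "A_labelling G1 u1 c1 L1" "\<And>v. v \<in> V1 \<Longrightarrow> L v = L1 v"
    using assms(4) unfolding type_III_labelling_def V1_def by blast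
  obtain u2 L2 where L2: "A_labelling G2 c2 u2 L2" "\<And>v. v \<in> V2 \<Longrightarrow> L v = L2 v + m"
    using assms(4) unfolding type_III_labelling_def V2_def by blast
  have Lab: "L b = n - 1" "L a = n" using assms(4) unfolding type_III_labelling_def by simp_all
  obtain s1 where s1: "good_labelling G1 V1 L 0 {c1} s1"
  proof -
    obtain s where "good_labelling G1 V1 L1 0 {c1} s"
      using A_labelling_good_labelling[OF L1(1) tl(1)] unfolding V1_def by blast
    from good_labelling_shift[OF this, of L 0] show thesis using L1(2) that by simp
  qed
  obtain s2 where s2: "good_labelling G2 V2 L m {u2} s2"
  proof -
    obtain s where "good_labelling G2 V2 L2 0 {u2} s"
      using A_labelling_good_labelling[OF L2(1) tl(2)] unfolding V2_def by blast
    from good_labelling_shift[OF this, of L m] show thesis using L2(2) that by simp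
  qed
  note d1 = good_labellingD[OF s1, unfolded card] and d2 = good_labellingD[OF s2, unfolded card]
  have Lc1: "L c1 = m" using d1(4)[of c1] by simp
  have Lc2: "L c2 = Suc m" using L2(2)[OF mem(2)] A_labelling_first[OF L2(1)] by simp
  define s where "s v = (if v \<in> V1 then s1 v else s2 v)" for v
  have sV1: "s v = s1 v" if "v \<in> V1" for v using that by (simp add: s_def)
  have sV2: "s v = s2 v" if "v \<in> V2" for v using that meet(3) by (auto simp: s_def)
  have inj: "inj_on L V1" "inj_on L V2" using d1(2) d2(2) by (simp_all add: bij_betw_def)
  have b1: "1 \<le> L v" "L v \<le> m" "L v < s v" "s v \<le> Suc m" if "v \<in> V1" for v
    using d1(5,6,8,9)[OF that] sV1[OF that] by simp_all
  have sm: "s v \<le> m" if "v \<in> V1" "v \<noteq> c1" for v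
    using b1(4)[OF that(1)] d1(7)[OF that(1)] that sV1[OF that(1)] by simp
  have sc1: "s c1 = Suc m" using d1(7)[OF mem(1)] sV1[OF mem(1)] by simp
  have Lm: "L v < m" if "v \<in> V1" "v \<noteq> c1" for v
    using b1(3)[OF that(1)] sm[OF that] by simp
  have b2: "m < L v" "L v \<le> n - 2" "L v < s v" "s v \<le> n - 1" if "v \<in> V2" for v
    using d2(5,6,8,9)[OF that] sV2[OF that] m by simp_all
  have Lc2': "Suc m < L v" if "v \<in> V2" "v \<noteq> c2" for v
  proof -
    have "L v \<noteq> L c2" using inj_onD[OF inj(2)] that mem(2) by blast
    then show ?thesis using b2(1)[OF that(1)] Lc2 by simp
  qed
  have injV: "x = y" if "x \<in> V1 \<union> V2" "y \<in> V1 \<union> V2" "L x = L y" for x y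
    using that inj_onD[OF inj(1)] inj_onD[OF inj(2)] b1(2)[of x] b1(2)[of y] b2(1)[of x] b2(1)[of y]
    by (metis UnE not_le)

  \<comment> \<open>Primary and complementary labels\<close>
  let ?pc = "primary_complementary G1 G2 L"
  \<comment> \<open>The side condition on \<open>x\<close> is vacuous for the labels
    \<open>n - 1\<close> and \<open>n\<close>, so the conclusion can later be used to show that
    \<open>a\<close> and \<open>b\<close> are not primary.\<close>
  have pc: "x \<in> V1 \<union> V2 \<and> s x = Suc j \<and> L x < j"
    if p: "?pc (L x) j" and x: "L x \<noteq> n - 1 \<Longrightarrow> L x \<noteq> n \<Longrightarrow> x \<in> V1 \<union> V2" for x j
  proof -
    obtain x' y z where t: "{x', y, z} \<in> three_cycles G1 \<union> three_cycles G2"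
        and l: "L x' = L x" "L y = j" "L x < j" "j < L z"
      using p unfolding primary_complementary_def by blast
    have x': "x' \<in> V1 \<union> V2"
      using t three_cycle_verts[OF wf1] three_cycle_verts[OF wf2] unfolding V1_def V2_def by blast
    then have "L x' \<le> n - 2" using b1(2)[of x'] b2(2)[of x'] m by auto
    then have xV: "x \<in> V1 \<union> V2" using x l(1) m by auto
    have "x' = x" by (rule injV[OF x' xV l(1)])
    note t = t[unfolded this]
    from t have "s x = Suc j"
    proof
      assume t: "{x, y, z} \<in> three_cycles G1"
      note v = three_cycle_verts[OF wf1 t, folded V1_def]
      show ?thesis using d1(11)[OF v t] l sV1[OF v(1)] by simp
    next
      assume t: "{x, y, z} \<in> three_cycles G2"
      note v = three_cycle_verts[OF wf2 t, folded V2_def]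
      show ?thesis using d2(11)[OF v t] l sV2[OF v(1)] by simp
    qed
    then show ?thesis using xV l(3) by simp
  qed
  have npc: "s x = Suc (L x)" if x: "x \<in> V1 \<union> V2" and np: "\<nexists>j. ?pc (L x) j" for x
    using x
  proof
    assume x: "x \<in> V1"
    have "s1 x = Suc (L x)"
      by (rule d1(12)[OF x]) (use np in \<open>auto simp: primary_complementary_def\<close>)
    then show ?thesis using sV1[OF x] by simp
  next
    assume x: "x \<in> V2"
    have "s2 x = Suc (L x)"
      by (rule d2(12)[OF x]) (use np in \<open>auto simp: primary_complementary_def\<close>)
    then show ?thesis using sV2[OF x] by simp
  qed

  \<comment> \<open>The vectors in coordinates\<close>
  obtain \<epsilon> where on: "\<And>i j. i \<in> {1..n} \<Longrightarrow> j \<in> {1..n} \<Longrightarrow> \<epsilon> i \<bullet> \<epsilon> j = of_bool (i = j)"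
    and \<alpha>: "\<And>i. i \<in> {1..<n} \<Longrightarrow> \<alpha> i = \<epsilon> i - \<epsilon> (Suc i)" "\<alpha> n = \<epsilon> (n - 1) + \<epsilon> n"
    using root_system_D_coordinates[OF assms(5,1)] by blast
  have tele: "(\<Sum>k = i..j. \<alpha> k) = \<epsilon> i - \<epsilon> (Suc j)" if "1 \<le> i" "i \<le> j" "j < n" for i j
  proof -
    have "{i..j} = {i..<Suc j}" by auto
    moreover have "(\<Sum>k = i..<Suc j. \<alpha> k) = \<epsilon> i - \<epsilon> (Suc j)"
      by (rule coordinates_telescope) (use \<alpha>(1) that in auto)
    ultimately show ?thesis by simp
  qed
  have \<alpha>n1: "\<alpha> (n - 1) = \<epsilon> (n - 1) - \<epsilon> n" using \<alpha>(1)[of "n - 1"] m by simp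
  have Sn: "Suc (n - 2) = n - 1" using m by simp

  define \<gamma> where "\<gamma> x = beta n m G1 G2 L \<alpha> (L x)" for x
  \<comment> \<open>The vertex \<open>c1\<close> is excluded because its vector ends in
    \<open>\<epsilon> n\<close> instead of \<open>\<epsilon> (Suc m)\<close>.\<close>
  have \<gamma>V: "\<gamma> x = \<epsilon> (L x) - \<epsilon> (s x)" if x: "x \<in> V1 \<union> V2" "x \<noteq> c1" for x
  proof -
    have Lx: "1 \<le> L x" "L x \<le> n - 2" "s x \<le> n - 1"
      using x(1) b1[of x] b2[of x] m sm[of x] x(2) by auto
    show ?thesis
    proof (cases "\<exists>j. ?pc (L x) j")
      case True
      then obtain j where j: "?pc (L x) j" by blast
      have sx: "s x = Suc j" "L x < j" using pc[OF j] x(1) by auto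
      have "(THE j. ?pc (L x) j) = j"
      proof (rule the_equality)
        show "k = j" if "?pc (L x) k" for k using pc[OF that] x(1) sx(1) by simp
      qed (rule j)
      then have "\<gamma> x = (\<Sum>k = L x..j. \<alpha> k)" unfolding \<gamma>_def beta_def using True by simp
      also have "\<dots> = \<epsilon> (L x) - \<epsilon> (s x)"
        unfolding sx(1) by (rule tele) (use sx Lx m in auto)
      finally show ?thesis .
    next
      case False
      have "L x \<noteq> m" using x Lm[of x] b2(1)[of x] by auto
      moreover have "L x \<noteq> n - 1" "L x \<noteq> n" using Lx m by auto
      ultimately have "\<gamma> x = \<alpha> (L x)" unfolding \<gamma>_def beta_def using False by auto
      then show ?thesis using \<alpha>(1)[of "L x"] npc[OF x(1) False] Lx m by simp
    qed
  qed
  have \<gamma>c1: "\<gamma> c1 = \<epsilon> m - \<epsilon> n"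
  proof -
    \<comment> \<open>A complementary label \<open>j\<close> would satisfy
      \<open>Suc j = s c1 = Suc m\<close>, against \<open>j > L c1 = m\<close>.\<close>
    have "\<not> ?pc (L c1) j" for j
    proof
      assume "?pc (L c1) j"
      from pc[OF this] show False using mem(1) sc1 Lc1 by auto
    qed
    then have "\<gamma> c1 = (\<Sum>k = m..n - 2. \<alpha> k) + \<alpha> (n - 1)" unfolding \<gamma>_def beta_def Lc1 by auto
    then show ?thesis using tele[of m "n - 2"] m Sn \<alpha>n1 by simp
  qed
  have npab: "\<not> ?pc (L x) j" if "x = a \<or> x = b" for x j
  proof
    assume "?pc (L x) j"
    from pc[OF this] have "x \<in> V1 \<union> V2" using that Lab by auto
    then show False using that mem by auto
  qed
  have \<gamma>b: "\<gamma> b = \<epsilon> (Suc m) - \<epsilon> n"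
  proof -
    have "\<gamma> b = (\<Sum>k = m + 1..n - 2. \<alpha> k) + \<alpha> (n - 1)"
      unfolding \<gamma>_def beta_def using npab[of b] Lab(1) m by auto
    then show ?thesis using tele[of "m + 1" "n - 2"] m Sn \<alpha>n1 by simp
  qed
  have \<gamma>a: "\<gamma> a = \<epsilon> (Suc m) + \<epsilon> n"
  proof -
    have "\<gamma> a = (\<Sum>k = m + 1..n - 2. \<alpha> k) + \<alpha> n"
      unfolding \<gamma>_def beta_def using npab[of a] Lab(2) m by auto
    then show ?thesis using tele[of "m + 1" "n - 2"] m Sn \<alpha>(2) by simp
  qed

  have vG: "verts G = V1 \<union> V2 \<union> {a, b}"
    using mem(1,2) unfolding G quiver_union_def vF V1_def V2_def by auto
  have fin: "finite V1" "finite V2" using d1(1) d2(1) by auto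
  have cardG: "card (verts G) = n"
  proof -
    have "card (V1 \<union> V2) = n - 2" using card fin meet(3) m by (simp add: card_Un_disjoint)
    moreover have "(V1 \<union> V2) \<inter> {a, b} = {}" "a \<noteq> b" using mem dist by auto
    ultimately show ?thesis unfolding vG using fin m by (simp add: card_Un_disjoint)
  qed

  \<comment> \<open>All vectors except that of \<open>a\<close> have the form
    \<open>\<epsilon> (p x) - \<epsilon> (t x)\<close>. The first indices are distinct apart from
    \<open>p b = p c2 = Suc m\<close>.\<close>
  define p where "p x = (if x = b then Suc m else L x)" for x
  define t where "t x = (if x = b \<or> x = c1 then n else s x)" for x
  have \<gamma>pt: "\<gamma> x = \<epsilon> (p x) - \<epsilon> (t x)" "1 \<le> p x" "p x < t x" "t x \<le> n" if "x \<in> V1 \<union> V2 \<union> {b}" for x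
  proof -
    consider "x = b" | "x = c1" | "x \<in> V1" "x \<noteq> c1" | "x \<in> V2" "x \<noteq> c1"
      using \<open>x \<in> V1 \<union> V2 \<union> {b}\<close> by blast
    then have "\<gamma> x = \<epsilon> (p x) - \<epsilon> (t x) \<and> 1 \<le> p x \<and> p x < t x \<and> t x \<le> n"
    proof cases
      case 1 then show ?thesis using \<gamma>b m by (simp add: p_def t_def)
    next
      case 2
      moreover have "c1 \<noteq> b" using dist by auto
      ultimately show ?thesis using \<gamma>c1 m Lc1 by (simp add: p_def t_def)
    next
      case 3
      moreover have "x \<noteq> b" using 3 mem by auto
      ultimately show ?thesis using \<gamma>V[of x] b1[of x] sm[of x] m by (simp add: p_def t_def)
    next
      case 4
      moreover have "x \<noteq> b" using 4 mem by auto
      ultimately show ?thesis using \<gamma>V[of x] b2[of x] m by (simp add: p_def t_def)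
    qed
    then show "\<gamma> x = \<epsilon> (p x) - \<epsilon> (t x)" "1 \<le> p x" "p x < t x" "t x \<le> n" by simp_all
  qed
  have pt1: "p x = L x" "t x = (if x = c1 then n else s x)" if "x \<in> V1" for x
    using that mem by (auto simp: p_def t_def)
  have pt2: "p x = L x" "t x = s x" if "x \<in> V2" for x
    using that mem by (auto simp: p_def t_def)
  have ptb: "p b = Suc m" "t b = n" by (simp_all add: p_def t_def)

  note roots = coordinates_roots[OF assms(5,1) on \<alpha>]
  have \<gamma>\<Phi>: "\<gamma> ` verts G \<subseteq> \<Phi>"
  proof
    fix r assume "r \<in> \<gamma> ` verts G"
    then obtain x where x: "x \<in> verts G" "r = \<gamma> x" by blast
    show "r \<in> \<Phi>"
    proof (cases "x = a")
      case True then show ?thesis using roots(2)[of "Suc m"] m \<gamma>a x(2) by simp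
    next
      case False
      then have "x \<in> V1 \<union> V2 \<union> {b}" using x(1) vG by auto
      from \<gamma>pt[OF this] show ?thesis using roots(1) x(2) by simp
    qed
  qed

  \<comment> \<open>Generation of the root lattice\<close>
  let ?M = "int_span (\<gamma> ` verts G)"
  have base: "\<gamma> x \<in> ?M" if "x \<in> verts G" for x
    using that by (intro int_mod.span_base) simp
  have M0: "0 \<in> ?M" and Madd: "u \<in> ?M \<Longrightarrow> v \<in> ?M \<Longrightarrow> u + v \<in> ?M"
    and Mdiff: "u \<in> ?M \<Longrightarrow> v \<in> ?M \<Longrightarrow> u - v \<in> ?M" for u v
    by (rule int_mod.span_zero int_mod.span_add int_mod.span_diff; assumption)+
  \<comment> \<open>The labels of \<open>V2\<close> are \<open>Suc m\<close>, ...,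
    \<open>n - 2\<close>, so every chain of differences from \<open>V2\<close> ends at
    \<open>n - 1\<close>.\<close>
  have ch2: "\<epsilon> i - \<epsilon> (n - 1) \<in> ?M" if "Suc m \<le> i" "i \<le> n - 1" for i
  proof (rule descending_diffs[of "Suc m" "n - 1", OF _ M0 Madd that])
    fix i assume i: "Suc m \<le> i" "i < n - 1"
    then have "i \<in> L ` V2" using bij_betw_imp_surj_on[OF d2(2)] m by auto
    then obtain x where x: "x \<in> V2" "L x = i" by blast
    then have "\<gamma> x = \<epsilon> i - \<epsilon> (s x)" using \<gamma>V[of x] mem by auto
    then show "\<exists>j>i. j \<le> n - 1 \<and> \<epsilon> i - \<epsilon> j \<in> ?M"
      using base[of x] b2(3,4)[OF x(1)] x vG by (intro exI[of _ "s x"]) auto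
  qed
  \<comment> \<open>Without \<open>c1\<close>, the second indices in \<open>V1\<close> are at most
    \<open>m\<close>, so these chains end at \<open>m\<close>.\<close>
  have ch1: "\<epsilon> i - \<epsilon> m \<in> ?M" if "1 \<le> i" "i \<le> m" for i
  proof (rule descending_diffs[of 1 m, OF _ M0 Madd that])
    fix i assume i: "1 \<le> i" "i < m"
    then have "i \<in> L ` V1" using bij_betw_imp_surj_on[OF d1(2)] by auto
    then obtain x where x: "x \<in> V1" "L x = i" by blast
    then have ne: "x \<noteq> c1" using Lc1 i by auto
    then have "\<gamma> x = \<epsilon> i - \<epsilon> (s x)" using \<gamma>V[of x] x by auto
    then show "\<exists>j>i. j \<le> m \<and> \<epsilon> i - \<epsilon> j \<in> ?M"
      using base[of x] b1(3)[OF x(1)] sm[OF x(1) ne] x vG by (intro exI[of _ "s x"]) auto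
  qed
  \<comment> \<open>The three pieces are linked by
    \<open>\<alpha> m = \<gamma> c1 - \<gamma> b\<close>. Subtracting
    \<open>\<epsilon> (Suc m) - \<epsilon> (n - 1)\<close> from \<open>\<gamma> b\<close> and from
    \<open>\<gamma> a\<close> gives \<open>\<alpha> (n - 1)\<close> and
    \<open>\<alpha> n\<close>.\<close>
  have gen: "\<alpha> i \<in> ?M" if i: "i \<in> {1..n}" for i
  proof -
    have ab: "\<gamma> a \<in> ?M" "\<gamma> b \<in> ?M" "\<gamma> c1 \<in> ?M" using base vG mem by auto
    consider "i < m" | "i = m" | "m < i" "i \<le> n - 2" | "i = n - 1" | "i = n" using i by atomize_elim auto
    then show ?thesis
    proof cases
      case 1
      then show ?thesis using Mdiff[OF ch1[of i] ch1[of "Suc i"]] \<alpha>(1)[of i] m i by simp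
    next
      case 2
      then show ?thesis using Mdiff[OF ab(3,2)] \<gamma>c1 \<gamma>b \<alpha>(1)[of m] m by simp
    next
      case 3
      then show ?thesis using Mdiff[OF ch2[of i] ch2[of "Suc i"]] \<alpha>(1)[of i] m i by simp
    next
      case 4
      then show ?thesis using Mdiff[OF ab(2) ch2[of "Suc m"]] \<gamma>b \<alpha>n1 m by simp
    next
      case 5
      then show ?thesis using Mdiff[OF ab(1) ch2[of "Suc m"]] \<gamma>a \<alpha>(2) m by (simp add: add.commute)
    qed
  qed
  have finG: "finite (verts G)" unfolding vG using fin by simp
  note basis = root_lattice_basis[OF assms(5) finG cardG \<gamma>\<Phi> gen]

  \<comment> \<open>Edges of the glued quiver against inner products\<close>
  have z1: "edges G1 x y = 0" if "x \<notin> V1 \<or> y \<notin> V1" for x y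
    using that wf1 unfolding V1_def wf_quiver_def edges_def by (metis add_is_0 not_gr0)
  have z2: "edges G2 x y = 0" if "x \<notin> V2 \<or> y \<notin> V2" for x y
    using that wf2 unfolding V2_def wf_quiver_def edges_def by (metis add_is_0 not_gr0)
  have eF: "edges F x y = of_bool ({x, y} \<in> {{c1, a}, {a, c2}, {c2, b}, {b, c1}})" for x y
  proof -
    define S where "S = {(c1, a), (a, c2), (c2, b), (b, c1)}"
    have "edges F x y = of_bool ((x, y) \<in> S) + of_bool ((y, x) \<in> S)"
      unfolding F_def four_cycle_def edges_def S_def by (simp only: quiver.simps of_bool_def)
    moreover have "\<not> ((x, y) \<in> S \<and> (y, x) \<in> S)" using dist unfolding S_def by auto
    moreover have "{x, y} \<in> {{c1, a}, {a, c2}, {c2, b}, {b, c1}} \<longleftrightarrow> (x, y) \<in> S \<or> (y, x) \<in> S"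
      unfolding S_def by (simp add: doubleton_eq_iff) blast
    ultimately show ?thesis by auto
  qed
  have cyc: "{x, y} \<notin> {{c1, a}, {a, c2}, {c2, b}, {b, c1}}" if "x \<in> V1 \<union> V2" "y \<in> V1 \<union> V2" for x y
  proof -
    have "x \<noteq> a" "x \<noteq> b" "y \<noteq> a" "y \<noteq> b" using that mem by auto
    then show ?thesis by (simp add: doubleton_eq_iff)
  qed
  have eG: "edges G x y = edges F x y + edges G1 x y + edges G2 x y" for x y
    unfolding G quiver_union_def edges_def by simp
  have v12: "x \<in> V1 \<Longrightarrow> x \<notin> V2" "x \<in> V2 \<Longrightarrow> x \<notin> V1" for x using meet(3) by blast+
  have e_in: "edges G x y = edges G1 x y + edges G2 x y" if "x \<in> V1 \<union> V2" "y \<in> V1 \<union> V2" for x y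
  proof -
    have "edges F x y = 0" unfolding eF using cyc[OF that] by (simp only: of_bool_eq)
    then show ?thesis unfolding eG by simp
  qed
  have D: "c1 \<noteq> a" "a \<noteq> c1" "c1 \<noteq> b" "b \<noteq> c1" "c1 \<noteq> c2" "c2 \<noteq> c1" "c2 \<noteq> a" "a \<noteq> c2" "c2 \<noteq> b" "b \<noteq> c2"
    "a \<noteq> b" "b \<noteq> a" using dist by auto
  have in_bi: "\<bar>\<gamma> x \<bullet> \<gamma> y\<bar> = of_bool (t x = p y \<or> t y = p x \<or> t x = t y)"
    if xy: "x \<in> V1 \<union> V2 \<union> {b}" "y \<in> V1 \<union> V2 \<union> {b}" "p x \<noteq> p y" for x y
    unfolding \<gamma>pt(1)[OF xy(1)] \<gamma>pt(1)[OF xy(2)]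
    by (rule inner_coordinate_diffs[OF on]) (use \<gamma>pt[OF xy(1)] \<gamma>pt[OF xy(2)] xy(3) in auto)
  \<comment> \<open>Since \<open>p x < t x \<le> n\<close>, the index \<open>p x\<close> is never
    \<open>n\<close>. For \<open>x = b\<close> the first and the last term cancel, in accordance
    with \<open>a\<close> and \<open>b\<close> not being joined.\<close>
  have in_a: "\<bar>\<gamma> x \<bullet> \<gamma> a\<bar> = \<bar>of_bool (p x = Suc m) - of_bool (t x = Suc m) - of_bool (t x = n)\<bar>"
    if x: "x \<in> V1 \<union> V2 \<union> {b}" for x
    unfolding \<gamma>pt(1)[OF x] \<gamma>a using \<gamma>pt[OF x] m
    by (simp add: inner_diff_left inner_add_right on)
  have sym: "\<bar>\<gamma> x \<bullet> \<gamma> y\<bar> = real (edges G x y) \<longleftrightarrow> \<bar>\<gamma> y \<bullet> \<gamma> x\<bar> = real (edges G y x)" for x y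
    by (simp add: inner_commute edges_commute)
  have i11: "\<bar>\<gamma> x \<bullet> \<gamma> y\<bar> = real (edges G x y)" if xy: "x \<in> V1" "y \<in> V1" "x \<noteq> y" for x y
  proof -
    have ne: "L x \<noteq> L y" using inj_onD[OF inj(1)] xy by blast
    have "edges G x y = edges G1 x y" using e_in[of x y] z2[of x y] v12[of x] xy by simp
    moreover have "edges G1 x y = of_bool (s x = L y \<or> s y = L x \<or> s x = s y)"
      using d1(10)[OF xy] sV1 xy by simp
    \<comment> \<open>Replacing \<open>s c1 = Suc m\<close> by \<open>t c1 = n\<close> changes no
      coincidence: all other indices in \<open>V1\<close> are at most \<open>m\<close>.\<close>
    moreover have "(t x = p y \<or> t y = p x \<or> t x = t y) \<longleftrightarrow> (s x = L y \<or> s y = L x \<or> s x = s y)"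
      using pt1[OF xy(1)] pt1[OF xy(2)] b1(2)[OF xy(1)] b1(2)[OF xy(2)] sm[OF xy(1)] sm[OF xy(2)]
        sc1 xy(3) m by auto
    ultimately show ?thesis using in_bi[of x y] xy pt1(1) ne by simp
  qed
  have i22: "\<bar>\<gamma> x \<bullet> \<gamma> y\<bar> = real (edges G x y)" if xy: "x \<in> V2" "y \<in> V2" "x \<noteq> y" for x y
  proof -
    have ne: "L x \<noteq> L y" using inj_onD[OF inj(2)] xy by blast
    have "edges G x y = edges G2 x y" using e_in[of x y] z1[of x y] v12[of x] xy by simp
    moreover have "edges G2 x y = of_bool (s x = L y \<or> s y = L x \<or> s x = s y)"
      using d2(10)[OF xy] sV2 xy by simp
    ultimately show ?thesis using in_bi[of x y] xy pt2 ne by simp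
  qed
  have i12: "\<bar>\<gamma> x \<bullet> \<gamma> y\<bar> = real (edges G x y)" if xy: "x \<in> V1" "y \<in> V2" for x y
  proof -
    have "edges G x y = 0" using e_in[of x y] z1[of x y] z2[of x y] v12(1)[of x] v12(2)[of y] xy by simp
    \<comment> \<open>The indices from \<open>V1\<close> are at most \<open>m\<close> or equal to
      \<open>n\<close>, those from \<open>V2\<close> lie between \<open>Suc m\<close> and
      \<open>n - 1\<close>.\<close>
    moreover have "\<not> (t x = p y \<or> t y = p x \<or> t x = t y)"
      using pt1[OF xy(1)] pt2[OF xy(2)] b1[OF xy(1)] b2[OF xy(2)] sm[OF xy(1)] m by auto
    moreover have "p x \<noteq> p y" using pt1[OF xy(1)] pt2[OF xy(2)] b1(2)[OF xy(1)] b2(1)[OF xy(2)] by simp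
    ultimately show ?thesis using in_bi[of x y] xy by simp
  qed
  have e_ab: "edges G x y = of_bool ({x, y} \<in> {{c1, a}, {a, c2}, {c2, b}, {b, c1}})"
    if "y = a \<or> y = b" for x y
  proof -
    have "y \<notin> V1" "y \<notin> V2" using that mem by blast+
    then show ?thesis unfolding eG eF z1[OF disjI2, OF \<open>y \<notin> V1\<close>] z2[OF disjI2, OF \<open>y \<notin> V2\<close>] by simp
  qed
  have nx: "x \<noteq> a \<and> x \<noteq> b \<and> x \<noteq> c2" if "x \<in> V1" for x using that mem by blast
  have i1b: "\<bar>\<gamma> x \<bullet> \<gamma> b\<bar> = real (edges G x b)" if x: "x \<in> V1" for x
  proof -
    have "edges G x b = of_bool (x = c1)"
      unfolding e_ab[OF disjI2[OF refl]] using nx[OF x] D by (simp add: doubleton_eq_iff)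
    moreover have "(t x = p b \<or> t b = p x \<or> t x = t b) \<longleftrightarrow> x = c1"
      using pt1[OF x] ptb b1(2)[OF x] sm[OF x] m by auto
    moreover have "p x \<noteq> p b" using pt1(1)[OF x] ptb b1(2)[OF x] by simp
    ultimately show ?thesis using in_bi[of x b] x by simp
  qed
  have i1a: "\<bar>\<gamma> x \<bullet> \<gamma> a\<bar> = real (edges G x a)" if x: "x \<in> V1" for x
  proof -
    have "edges G x a = of_bool (x = c1)"
      unfolding e_ab[OF disjI1[OF refl]] using nx[OF x] D by (simp add: doubleton_eq_iff)
    then show ?thesis using in_a[of x] x pt1[OF x] b1(2)[OF x] sm[OF x] m by (cases "x = c1") auto
  qed
  have nx: "x \<noteq> a \<and> x \<noteq> b \<and> x \<noteq> c1" if "x \<in> V2" for x using that mem by blast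
  have i2b: "\<bar>\<gamma> x \<bullet> \<gamma> b\<bar> = real (edges G x b)" if x: "x \<in> V2" for x
  proof -
    have e: "edges G x b = of_bool (x = c2)"
      unfolding e_ab[OF disjI2[OF refl]] using nx[OF x] D by (simp add: doubleton_eq_iff)
    show ?thesis
    proof (cases "x = c2")
      case True
      \<comment> \<open>The first indices of \<open>c2\<close> and \<open>b\<close> coincide, so
        \<open>in_bi\<close> does not apply; the inner product is 1 because the second indices
        differ.\<close>
      have "s c2 \<le> n - 1" "Suc m < s c2" using b2(3,4)[OF mem(2)] Lc2 by simp_all
      moreover have "\<gamma> c2 = \<epsilon> (Suc m) - \<epsilon> (s c2)" using \<gamma>V[of c2] mem(2) D Lc2 by simp
      ultimately have "\<gamma> c2 \<bullet> \<gamma> b = 1"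
        unfolding \<gamma>b using m by (auto simp: inner_diff_left inner_diff_right on)
      then show ?thesis using e True by simp
    next
      case False
      have "\<not> (t x = p b \<or> t b = p x \<or> t x = t b)"
        using pt2[OF x] ptb b2[OF x] Lc2'[OF x False] m by auto
      moreover have "p x \<noteq> p b" using pt2(1)[OF x] ptb Lc2'[OF x False] by simp
      ultimately show ?thesis using in_bi[of x b] x e False by simp
    qed
  qed
  have i2a: "\<bar>\<gamma> x \<bullet> \<gamma> a\<bar> = real (edges G x a)" if x: "x \<in> V2" for x
  proof -
    have "edges G x a = of_bool (x = c2)"
      unfolding e_ab[OF disjI1[OF refl]] using nx[OF x] D by (simp add: doubleton_eq_iff)
    moreover have "L x = Suc m \<longleftrightarrow> x = c2" using Lc2 Lc2'[OF x] by (cases "x = c2") auto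
    ultimately show ?thesis using in_a[of x] x pt2[OF x] b2[OF x] m by auto
  qed
  have iba: "\<bar>\<gamma> b \<bullet> \<gamma> a\<bar> = real (edges G b a)"
  proof -
    have "edges G b a = 0"
      unfolding e_ab[OF disjI1[OF refl]] using D by (simp add: doubleton_eq_iff)
    then show ?thesis using in_a[of b] ptb m by simp
  qed
  have "\<bar>\<gamma> x \<bullet> \<gamma> y\<bar> = real (edges G x y)" if xy: "x \<in> verts G" "y \<in> verts G" "x \<noteq> y" for x y
  proof -
    have "x \<in> V1 \<or> x \<in> V2 \<or> x = a \<or> x = b" "y \<in> V1 \<or> y \<in> V2 \<or> y = a \<or> y = b"
      using xy(1,2) unfolding vG by auto
    then show ?thesis
      by (elim disjE) (metis xy(3) i11 i22 i12 i1a i1b i2a i2b iba sym)+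
  qed
  then have "companion_basis \<Phi> G \<gamma>"
    unfolding companion_basis_def using \<gamma>\<Phi> basis by blast
  then show ?thesis unfolding \<gamma>_def .
qed

end
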